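(* Consider the sparse normal means model: one observes $X=(X_1,\ldots,X_n)$ with $X_i=\theta_i+\varepsilon_i$, $\varepsilon_i$ i.i.d. $\mathcal{N}(0,1)$, with $P_\theta,E_\theta$ the law of $X$ and expectation under $\theta$, and $\ell_0[s_n]=\{\theta\in\mathbb{R}^n:\#\{i:\theta_i\ne0\}\le s_n\}$. Let $\lambda_0=5\sqrt{2\pi}\,n$ and $\lambda_1=0.05$, let $G_0=\mathrm{Lap}(\lambda_0)$ with density $\gamma_0(x)=\frac{\lambda_0}{2}e^{-\lambda_0|x|}$ and $G_1=\mathrm{Cauchy}(1/\lambda_1)$ with density $\gamma_1(x)=\frac{\lambda_1}{\pi}(1+\lambda_1^2x^2)^{-1}$, and for $\alpha\in[0,1]$ let $\Pi_\alpha=\bigotimes_{i=1}^n((1-\alpha)G_0+\alpha G_1)$ (spike and slab LASSO prior with Cauchy slab). Let $g_k=\phi*\gamma_k$ ($\phi$ the standard normal density), and let $\hat\alpha$ be a maximiser over $[\mathcal{C}\log n/n,1]$ of $\ell_n(\alpha)=\sum_{i=1}^n\log((1-\alpha)g_0(X_i)+\alpha g_1(X_i))$, where $\mathcal{C}$ is a suitably large constant. Then (for $\mathcal{C}$ large enough) there exist $C>0$, $N_0>0$, $c_0,c_1>0$ such that for any $n\ge N_0$ and any $s_n$ with $c_1\log^2n\le s_n\le c_0n$, \[ \sup_{\theta_0\in\ell_0[s_n]}E_{\theta_0}\int\|\theta-\theta_0\|^2\,d\Pi_{\hat\alpha}(\theta\mid X)\le C s_n\log n. \] If one only assumes $s_n\le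 c_0n$, the bound holds with $Cs_n\log n$ replaced by $C(s_n\log n+\log^3 n)$.
   Context: For fixed $\alpha$, the posterior is $\Pi_\alpha[\cdot\mid X]=\bigotimes_{i=1}^n((1-a(X_i))G_{0,X_i}+a(X_i)G_{1,X_i})$, where $a(x)=\frac{\alpha g_1(x)}{(1-\alpha)g_0(x)+\alpha g_1(x)}$ and $G_{k,x}$ has Lebesgue density $\gamma_{k,x}(u)=\phi(x-u)\gamma_k(u)/g_k(x)$, $k=0,1$; $\Pi_{\hat\alpha}[\cdot\mid X]$ is this with $\alpha=\hat\alpha$. $\|\cdot\|$ is the Euclidean norm. *)

theory Defs
  imports "HOL-Probability.Probability"
begin

text \<open>Sparse normal means model with spike-and-slab LASSO prior (Laplace spike,
Cauchy slab) and empirical Bayes choice of the mixing weight.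
Vectors in R^n are functions nat => real, coordinates i < n.\<close>

definition phi :: "real \<Rightarrow> real" where
  "phi x = std_normal_density x"

definition lam0 :: "nat \<Rightarrow> real" where
  "lam0 n = 5 * sqrt (2 * pi) * real n"

definition lam1 :: real where
  "lam1 = 0.05"

definition gamma0 :: "nat \<Rightarrow> real \<Rightarrow> real" where
  "gamma0 n x = lam0 n / 2 * exp (- lam0 n * \<bar>x\<bar>)"

definition gamma1 :: "real \<Rightarrow> real" where
  "gamma1 x = lam1 / pi * inverse (1 + lam1\<^sup>2 * x\<^sup>2)"

definition g0 :: "nat \<Rightarrow> real \<Rightarrow> real" where
  "g0 n x = (\<integral>u. phi (x - u) * gamma0 n u \<partial>lborel)"

definition g1 :: "real \<Rightarrow> real" where
  "g1 x = (\<integral>u. phi (x - u) * gamma1 u \<partial>lborel)"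

definition loglik :: "nat \<Rightarrow> (nat \<Rightarrow> real) \<Rightarrow> real \<Rightarrow> real" where
  "loglik n X \<alpha> = (\<Sum>i<n. ln ((1 - \<alpha>) * g0 n (X i) + \<alpha> * g1 (X i)))"

definition post_a :: "nat \<Rightarrow> real \<Rightarrow> real \<Rightarrow> real" where
  "post_a n \<alpha> x = \<alpha> * g1 x / ((1 - \<alpha>) * g0 n x + \<alpha> * g1 x)"

definition post_dens :: "nat \<Rightarrow> real \<Rightarrow> real \<Rightarrow> real \<Rightarrow> real" where
  "post_dens n \<alpha> x u =
     (1 - post_a n \<alpha> x) * (phi (x - u) * gamma0 n u / g0 n x)
     + post_a n \<alpha> x * (phi (x - u) * gamma1 u / g1 x)"

definition posterior :: "nat \<Rightarrow> real \<Rightarrow> (nat \<Rightarrow> real) \<Rightarrow> (nat \<Rightarrow> real) measure" where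
  "posterior n \<alpha> X = PiM {..<n} (\<lambda>i. density lborel (\<lambda>u. ennreal (post_dens n \<alpha> (X i) u)))"

definition data_law :: "nat \<Rightarrow> (nat \<Rightarrow> real) \<Rightarrow> (nat \<Rightarrow> real) measure" where
  "data_law n \<theta> = PiM {..<n} (\<lambda>i. density lborel (normal_density (\<theta> i) 1))"

definition ell0 :: "nat \<Rightarrow> nat \<Rightarrow> (nat \<Rightarrow> real) set" where
  "ell0 n s = {\<theta>. card {i\<in>{..<n}. \<theta> i \<noteq> 0} \<le> s}"

definition is_mmle :: "nat \<Rightarrow> real \<Rightarrow> ((nat \<Rightarrow> real) \<Rightarrow> real) \<Rightarrow> bool" where
  "is_mmle n Ccal ahat \<longleftrightarrow>
     ahat \<in> borel_measurable (PiM {..<n} (\<lambda>_. lborel)) \<and>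
     (\<forall>X. ahat X \<in> {Ccal * ln (real n) / real n .. 1} \<and>
          (\<forall>\<alpha>\<in>{Ccal * ln (real n) / real n .. 1}. loglik n X \<alpha> \<le> loglik n X (ahat X)))"

definition post_risk :: "nat \<Rightarrow> ((nat \<Rightarrow> real) \<Rightarrow> real) \<Rightarrow> (nat \<Rightarrow> real) \<Rightarrow> ennreal" where
  "post_risk n ahat \<theta>0 =
     (\<integral>\<^sup>+ X. (\<integral>\<^sup>+ \<theta>. ennreal (\<Sum>i<n. (\<theta> i - \<theta>0 i)\<^sup>2) \<partial>posterior n (ahat X) X) \<partial>data_law n \<theta>0)"

end

theory Submission
  imports Defs
begin

text \<open>
  The posterior risk is a sum over coordinates. At a signal coordinate the risk is of order
  \<open>log n\<close> for every admissible weight, because beyond a multiple of \<open>\<surd>log n\<close> the slab dominates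
  the spike even with weight \<open>1 / n\<close>. At a null coordinate the risk is governed by the
  posterior slab weight, whose mean is of order \<open>\<alpha> \<surd>log n\<close> for fixed \<open>\<alpha>\<close>, so it remains to bound
  the empirical Bayes weight by \<open>2 \<beta>\<close> with \<open>\<beta>\<close> of order \<open>(s \<surd>log n + log\<^sup>2 n) / n\<close>.

  By concavity of the log-likelihood, a maximiser above \<open>2 \<beta>\<close> forces the likelihood ratio
  \<open>W\<close> of \<open>2 \<beta>\<close> against \<open>\<beta>\<close> to be at least \<open>1\<close>, and by Markov's inequality it suffices that
  \<open>W\<close> has mean of order \<open>1 / n\<^sup>2\<close>. A signal contributes at most a factor \<open>2\<close>. For a null, the
  standard normal density is at most \<open>1 + 1 / n\<close> times the spike marginal \<open>g0\<close>, and under \<open>g0\<close> the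
  ratio has mean \<open>1 - \<beta>\<^sup>2 \<integral> (g1 - g0)\<^sup>2 / ((1 - \<beta>) g0 + \<beta> g1)\<close>, where the region
  \<open>6 \<surd>log n \<le> x \<le> 12 \<surd>log n\<close> alone makes the subtracted term at least a multiple of
  \<open>\<beta> / \<surd>log n\<close>, by the heavy tails of the Cauchy slab.
\<close>

subsection \<open>Laplace and Cauchy densities\<close>

text \<open>The rate is a free parameter because the spike, of rate \<open>lam0 n\<close>, is later
  compared with the Laplace density of half that rate.\<close>

definition laplace_density :: "real \<Rightarrow> real \<Rightarrow> real" where
  "laplace_density l u = l / 2 * exp (- l * \<bar>u\<bar>)"

lemma borel_measurable_laplace_density [measurable]: "laplace_density l \<in> borel_measurable borel"
  unfolding laplace_density_def by measurable

lemma laplace_density_nonneg: "0 \<le> l \<Longrightarrow> 0 \<le> laplace_density l u"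
  by (simp add: laplace_density_def)

text \<open>On the positive half-line the Laplace density is half an exponential density, whose
  moments are known in Erlang form. The moments on the whole line then follow by even or odd
  symmetry.\<close>

lemma has_bochner_integral_laplace_half:
  assumes l: "0 < l"
  shows "has_bochner_integral lborel (\<lambda>u. indicator {0..} u *\<^sub>R (u ^ k * laplace_density l u))
           (fact k / (2 * l ^ k))"
proof (rule has_bochner_integral_nn_integral)
  have eq: "indicator {0..} u *\<^sub>R (u ^ k * laplace_density l u) = 1/2 * (erlang_density 0 l u * u ^ k)" for u
    by (auto simp: laplace_density_def erlang_density_def split: split_indicator)
  have pos: "0 \<le> erlang_density 0 l u * u ^ k" for u
    using l by (auto simp: erlang_density_def)
  have "(\<integral>\<^sup>+u. ennreal (indicator {0..} u *\<^sub>R (u ^ k * laplace_density l u)) \<partial>lborel)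
      = (\<integral>\<^sup>+u. ennreal (1/2) * ennreal (erlang_density 0 l u * u ^ k) \<partial>lborel)"
    unfolding eq using pos by (intro nn_integral_cong ennreal_mult) auto
  also have "\<dots> = ennreal (1/2) * ennreal (fact k / l ^ k)"
    using nn_integral_erlang_ith_moment[OF l, of 0 k] by (subst nn_integral_cmult) auto
  also have "\<dots> = ennreal (fact k / (2 * l ^ k))"
    using l by (subst ennreal_mult[symmetric]) auto
  finally show "(\<integral>\<^sup>+u. ennreal (indicator {0..} u *\<^sub>R (u ^ k * laplace_density l u)) \<partial>lborel)
      = ennreal (fact k / (2 * l ^ k))" .
qed (use l in \<open>auto simp: laplace_density_def split: split_indicator\<close>)

lemma has_bochner_integral_laplace_even:
  assumes "0 < l" "even k"
  shows "has_bochner_integral lborel (\<lambda>u. u ^ k * laplace_density l u) (fact k / l ^ k)"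
  using has_bochner_integral_even_function[OF has_bochner_integral_laplace_half[OF assms(1), of k]] assms
  by (auto simp: laplace_density_def)

lemma has_bochner_integral_laplace_odd:
  assumes "0 < l" "odd k"
  shows "has_bochner_integral lborel (\<lambda>u. u ^ k * laplace_density l u) 0"
  using has_bochner_integral_odd_function[OF has_bochner_integral_laplace_half[OF assms(1), of k]] assms
  by (auto simp: laplace_density_def)

lemma has_bochner_integral_laplace_density:
  "0 < l \<Longrightarrow> has_bochner_integral lborel (laplace_density l) 1"
  using has_bochner_integral_laplace_even[of l 0] by simp

lemma has_bochner_integral_gamma1: "has_bochner_integral lborel gamma1 1"
proof -
  have "(\<integral>\<^sup>+u. ennreal (gamma1 u) * indicator {0..} u \<partial>lborel) = ennreal (1/2 - arctan (lam1 * 0) / pi)"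
  proof (rule nn_integral_FTC_atLeast)
    show "gamma1 \<in> borel_measurable borel"
      unfolding gamma1_def by measurable
    show "((\<lambda>u. arctan (lam1 * u) / pi) has_real_derivative gamma1 u) (at u)" for u
      unfolding gamma1_def
      by (rule derivative_eq_intros refl | simp add: power_mult_distrib divide_inverse)+
    show "0 \<le> gamma1 u" for u
      by (simp add: gamma1_def lam1_def add_nonneg_nonneg)
    have "filterlim (\<lambda>u. lam1 * u) at_top at_top"
      by (rule filterlim_tendsto_pos_mult_at_top[OF tendsto_const])
         (auto simp: lam1_def filterlim_ident)
    then have "((\<lambda>u. arctan (lam1 * u)) \<longlongrightarrow> pi / 2) at_top"
      by (rule filterlim_compose[OF tendsto_arctan_at_top])
    then show "((\<lambda>u. arctan (lam1 * u) / pi) \<longlongrightarrow> 1 / 2) at_top"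
      by (auto dest: tendsto_divide[OF _ tendsto_const[of pi]])
  qed
  moreover have "ennreal (indicator {0..} u *\<^sub>R gamma1 u) = ennreal (gamma1 u) * indicator {0..} u" for u
    by (auto split: split_indicator)
  ultimately have nn: "(\<integral>\<^sup>+u. ennreal (indicator {0..} u *\<^sub>R gamma1 u) \<partial>lborel) = ennreal (1/2)"
    by simp
  have "has_bochner_integral lborel (\<lambda>u. indicator {0..} u *\<^sub>R gamma1 u) (1/2)"
    by (rule has_bochner_integral_nn_integral[OF _ _ _ nn])
       (auto simp: gamma1_def lam1_def add_nonneg_nonneg)
  from has_bochner_integral_even_function[OF this] show ?thesis
    by (simp add: gamma1_def[abs_def])
qed

subsection \<open>Marginal densities\<close>

lemma phi_pos: "0 < phi x"
  by (simp add: phi_def normal_density_pos)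

lemma one_le_sqrt_2pi: "1 \<le> sqrt (2 * pi)"
  using pi_gt3 by (simp add: real_le_rsqrt)

lemma phi_le_1: "phi x \<le> 1"
proof -
  have "1 / sqrt (2 * pi) * exp (- x\<^sup>2 / 2) \<le> 1 * 1"
    using one_le_sqrt_2pi by (intro mult_mono) auto
  then show ?thesis
    by (simp add: phi_def std_normal_density_def)
qed

lemma borel_measurable_phi [measurable]: "phi \<in> borel_measurable borel"
  unfolding phi_def by measurable

text \<open>Exponential tilting takes \<open>phi x\<close> out of an integral over \<open>u\<close>.
  Spike quantities thereby become multiples of \<open>phi x\<close>, and then of
  \<open>g0 n x\<close> by \<open>phi_le_g0\<close>.\<close>

lemma phi_diff: "phi (x - u) = phi x * exp (x * u - u\<^sup>2 / 2)"
  by (simp add: phi_def std_normal_density_def exp_add[symmetric] power2_eq_square field_simps)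

text \<open>The reflection sending \<open>u\<close> to \<open>x - u\<close> turns these into the
  even moments of the standard normal law.\<close>

lemma has_bochner_integral_phi_moment:
  "has_bochner_integral lborel (\<lambda>u. (x - u) ^ (2 * k) * phi (x - u)) (fact (2 * k) / (2 ^ k * fact k))"
  using std_normal_moment_even[of k]
  by (subst (asm) lborel_has_bochner_integral_real_affine_iff[where c="-1" and t=x])
     (auto simp: phi_def mult.commute)

lemma has_bochner_integral_phi_moments:
  "has_bochner_integral lborel (\<lambda>u. phi (x - u)) 1"
  "has_bochner_integral lborel (\<lambda>u. (x - u)\<^sup>2 * phi (x - u)) 1"
  "has_bochner_integral lborel (\<lambda>u. (x - u) ^ 4 * phi (x - u)) 3"
  using has_bochner_integral_phi_moment[of x 0] has_bochner_integral_phi_moment[of x 1]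
    has_bochner_integral_phi_moment[of x 2]
  by (simp_all add: fact_numeral)

text \<open>The later estimates see the spike rate through this linear growth in
  \<open>n\<close>.\<close>

lemma lam0_ge: assumes "1 \<le> n" shows "5 * real n \<le> lam0 n"
  using assms one_le_sqrt_2pi by (simp add: lam0_def)

lemma lam0_pos: "1 \<le> n \<Longrightarrow> 0 < lam0 n"
  using lam0_ge[of n] by simp

lemma gamma0_eq: "gamma0 n = laplace_density (lam0 n)"
  by (auto simp: gamma0_def laplace_density_def)

lemma gamma0_pos: "1 \<le> n \<Longrightarrow> 0 < gamma0 n u"
  using lam0_pos[of n] by (simp add: gamma0_def)

lemma borel_measurable_gamma0 [measurable]: "gamma0 n \<in> borel_measurable borel"
  unfolding gamma0_eq by measurable

lemma gamma1_pos: "0 < gamma1 u"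
  by (simp add: gamma1_def lam1_def add_pos_nonneg)

lemma borel_measurable_gamma1 [measurable]: "gamma1 \<in> borel_measurable borel"
  unfolding gamma1_def by measurable

lemma integrable_phi_mult:
  assumes "integrable lborel f"
  shows "integrable lborel (\<lambda>u. phi (x - u) * f u)"
proof (rule Bochner_Integration.integrable_bound[OF assms])
  have [measurable]: "f \<in> borel_measurable borel"
    using borel_measurable_integrable[OF assms] by simp
  show "(\<lambda>u. phi (x - u) * f u) \<in> borel_measurable lborel"
    by measurable
  have "phi (x - u) * \<bar>f u\<bar> \<le> 1 * \<bar>f u\<bar>" for u
    by (intro mult_right_mono phi_le_1) auto
  then show "AE u in lborel. norm (phi (x - u) * f u) \<le> norm (f u)"
    by (auto simp: abs_mult less_imp_le[OF phi_pos])
qed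

text \<open>\<open>g0\<close> is defined by a Bochner integral, which takes the default value 0 when
  integrability fails. This form carries value and integrability together.\<close>

lemma has_bochner_integral_g0:
  assumes "1 \<le> n"
  shows "has_bochner_integral lborel (\<lambda>u. phi (x - u) * gamma0 n u) (g0 n x)"
  unfolding g0_def gamma0_eq
  using integrable_phi_mult[OF has_bochner_integral_laplace_density[OF lam0_pos[OF assms], THEN integrable.intros]]
  by (rule has_bochner_integral_integrable)

lemma has_bochner_integral_g1:
  "has_bochner_integral lborel (\<lambda>u. phi (x - u) * gamma1 u) (g1 x)"
  unfolding g1_def
  using integrable_phi_mult[OF has_bochner_integral_gamma1[THEN integrable.intros]]
  by (rule has_bochner_integral_integrable)

text \<open>The bounds on \<open>g0\<close> and \<open>g1\<close> below all have this form: a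
  pointwise comparison with a function whose integral is known in closed form.\<close>

lemma has_bochner_integral_mono:
  fixes f g :: "'a \<Rightarrow> real"
  assumes "has_bochner_integral M f a" "has_bochner_integral M g b" "\<And>x. f x \<le> g x"
  shows "a \<le> b"
  using integral_mono[of M f g] assms by (auto simp: has_bochner_integral_iff)

lemma borel_measurable_g0 [measurable]: "g0 n \<in> borel_measurable borel"
  unfolding g0_def by measurable

lemma borel_measurable_g1 [measurable]: "g1 \<in> borel_measurable borel"
  unfolding g1_def by measurable

text \<open>By Tonelli, a convolution of two probability densities has total mass one. The integrand
  is nonnegative, so no joint integrability has to be shown. The unit mass of the marginals is used
  for the mean of the likelihood ratio.\<close>

lemma nn_integral_phi_convolution:
  assumes f: "has_bochner_integral lborel f 1" "\<And>u. 0 \<le> f u"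
    and g: "\<And>x. has_bochner_integral lborel (\<lambda>u. phi (x - u) * f u) (g x)"
  shows "(\<integral>\<^sup>+x. ennreal (g x) \<partial>lborel) = 1"
proof -
  have [measurable]: "f \<in> borel_measurable borel"
    using borel_measurable_has_bochner_integral[OF f(1)] by simp
  have "(\<integral>\<^sup>+x. ennreal (g x) \<partial>lborel) = (\<integral>\<^sup>+x. (\<integral>\<^sup>+u. ennreal (phi (x - u) * f u) \<partial>lborel) \<partial>lborel)"
    using g f(2) by (intro nn_integral_cong)
      (auto simp: has_bochner_integral_iff nn_integral_eq_integral less_imp_le[OF phi_pos])
  also have "\<dots> = (\<integral>\<^sup>+u. (\<integral>\<^sup>+x. ennreal (phi (x - u) * f u) \<partial>lborel) \<partial>lborel)"
    by (rule lborel_pair.Fubini') measurable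
  also have "\<dots> = (\<integral>\<^sup>+u. ennreal (f u) \<partial>lborel)"
  proof (rule nn_integral_cong)
    fix u
    have "(\<integral>\<^sup>+x. ennreal (phi (x - u) * f u) \<partial>lborel) = (\<integral>\<^sup>+x. ennreal (f u) * ennreal (phi (u - x)) \<partial>lborel)"
      using f(2) phi_pos by (intro nn_integral_cong)
        (auto simp: ennreal_mult[symmetric] less_imp_le phi_def std_normal_density_def power2_commute mult.commute)
    also have "\<dots> = ennreal (f u)"
      using has_bochner_integral_phi_moments(1)[of u] phi_pos
      by (subst nn_integral_cmult) (auto simp: has_bochner_integral_iff nn_integral_eq_integral less_imp_le)
    finally show "(\<integral>\<^sup>+x. ennreal (phi (x - u) * f u) \<partial>lborel) = ennreal (f u)" .
  qed
  also have "\<dots> = 1"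
    using f by (auto simp: has_bochner_integral_iff nn_integral_eq_integral)
  finally show ?thesis .
qed

lemma nn_integral_g0: "1 \<le> n \<Longrightarrow> (\<integral>\<^sup>+x. ennreal (g0 n x) \<partial>lborel) = 1"
  by (rule nn_integral_phi_convolution[OF _ _ has_bochner_integral_g0])
     (auto simp: gamma0_eq has_bochner_integral_laplace_density laplace_density_nonneg lam0_pos less_imp_le)

lemma nn_integral_g1: "(\<integral>\<^sup>+x. ennreal (g1 x) \<partial>lborel) = 1"
  by (rule nn_integral_phi_convolution[OF has_bochner_integral_gamma1 _ has_bochner_integral_g1])
     (simp add: less_imp_le gamma1_pos)

text \<open>After tilting, the exponential is bounded below by its tangent at 0. The linear term
  integrates to 0 by symmetry, and the quadratic one gives half the Laplace second moment
  \<open>2 / (lam0 n)\<^sup>2\<close>.\<close>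

lemma g0_ge_phi:
  assumes "1 \<le> n"
  shows "(1 - 1 / (lam0 n)\<^sup>2) * phi x \<le> g0 n x"
proof (rule has_bochner_integral_mono[OF _ has_bochner_integral_g0[OF assms]])
  note lap = has_bochner_integral_laplace_density[OF lam0_pos[OF assms]]
    has_bochner_integral_laplace_odd[OF lam0_pos[OF assms], of 1]
    has_bochner_integral_laplace_even[OF lam0_pos[OF assms], of 2]
  have "has_bochner_integral lborel
      (\<lambda>u. phi x * (gamma0 n u + x * (u ^ 1 * gamma0 n u) - (1/2) * (u ^ 2 * gamma0 n u)))
      (phi x * (1 + x * 0 - (1/2) * (fact 2 / (lam0 n) ^ 2)))"
    unfolding gamma0_eq
    by (intro has_bochner_integral_mult_right has_bochner_integral_add has_bochner_integral_diff lap) auto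
  then show "has_bochner_integral lborel
      (\<lambda>u. phi x * (gamma0 n u + x * (u ^ 1 * gamma0 n u) - (1/2) * (u ^ 2 * gamma0 n u)))
      ((1 - 1 / (lam0 n)\<^sup>2) * phi x)"
    by (simp add: mult.commute)
  fix u
  have "phi x * (gamma0 n u + x * (u ^ 1 * gamma0 n u) - (1/2) * (u ^ 2 * gamma0 n u))
      = phi x * (1 + (x * u - u\<^sup>2 / 2)) * gamma0 n u"
    by (simp add: algebra_simps)
  also have "\<dots> \<le> phi x * exp (x * u - u\<^sup>2 / 2) * gamma0 n u"
    using phi_pos gamma0_pos[OF assms] exp_ge_add_one_self[of "x * u - u\<^sup>2 / 2"]
    by (intro mult_right_mono mult_left_mono) (auto simp: less_imp_le)
  finally show "phi x * (gamma0 n u + x * (u ^ 1 * gamma0 n u) - (1/2) * (u ^ 2 * gamma0 n u))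
      \<le> phi (x - u) * gamma0 n u"
    by (simp add: phi_diff)
qed

text \<open>The first form loses only a factor 1 + 1/n, so a product over up to n null coordinates
  loses at most a factor e. The cruder second form serves for pointwise bounds.\<close>

lemma phi_le_g0:
  assumes "1 \<le> n"
  shows "phi x \<le> (1 + 1 / real n) * g0 n x" "phi x \<le> 2 * g0 n x"
proof -
  have n: "1 \<le> real n" using assms by simp
  have "5 * real n \<le> lam0 n" using lam0_ge[OF assms] .
  then have "(5 * real n)\<^sup>2 \<le> (lam0 n)\<^sup>2"
    using n by (intro power_mono) auto
  then have "2 * real n \<le> (lam0 n)\<^sup>2"
    using mult_left_mono[OF n, of "real n"] by (simp add: power2_eq_square)
  then have "1 / (lam0 n)\<^sup>2 \<le> 1 / (2 * real n)"
    using n lam0_pos[OF assms] by (intro divide_left_mono) auto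
  then have "(1 - 1 / (2 * real n)) * phi x \<le> (1 - 1 / (lam0 n)\<^sup>2) * phi x"
    using phi_pos[of x] by (intro mult_right_mono) auto
  also have "\<dots> \<le> g0 n x" by (rule g0_ge_phi[OF assms])
  finally have *: "(1 - 1 / (2 * real n)) * phi x \<le> g0 n x" .
  have "1 \<le> (1 + 1 / real n) * (1 - 1 / (2 * real n))"
    using n by (simp add: field_simps)
  then have "1 * phi x \<le> ((1 + 1 / real n) * (1 - 1 / (2 * real n))) * phi x"
    using phi_pos[of x] by (intro mult_right_mono) auto
  also have "\<dots> \<le> (1 + 1 / real n) * g0 n x"
    using * n by (simp only: mult.assoc) (intro mult_left_mono, auto)
  finally show 1: "phi x \<le> (1 + 1 / real n) * g0 n x" by simp
  have "1/2 * phi x \<le> (1 - 1 / (2 * real n)) * phi x"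
    using n phi_pos[of x] by (intro mult_right_mono) (auto simp: field_simps)
  with * show "phi x \<le> 2 * g0 n x" by simp
qed

lemma g0_pos: "1 \<le> n \<Longrightarrow> 0 < g0 n x"
  using phi_le_g0(2)[of n x] phi_pos[of x] by linarith

section \<open>Polynomial bounds for the slab marginal\<close>

text \<open>This is a Peetre inequality: since \<open>lam1\<close> is at most 1, a shift changes the
  Cauchy density by at most a quadratic factor in the shift. Low-order normal moments then make
  \<open>gamma1\<close> and \<open>g1\<close> comparable.\<close>

lemma gamma1_peetre: "gamma1 u \<le> 2 * (1 + (x - u)\<^sup>2) * gamma1 x"
proof -
  define k where "k = lam1\<^sup>2"
  have k: "0 \<le> k" "k \<le> 1" by (auto simp: k_def lam1_def power2_eq_square)
  have p: "1 + k * x\<^sup>2 > 0" "1 + k * u\<^sup>2 > 0" using k by (auto intro!: add_pos_nonneg)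
  have "x\<^sup>2 \<le> 2 * u\<^sup>2 + 2 * (x - u)\<^sup>2"
    using zero_le_power2[of "x - 2 * u"] by (simp add: power2_eq_square algebra_simps)
  then have "k * x\<^sup>2 \<le> k * (2 * u\<^sup>2 + 2 * (x - u)\<^sup>2)" using k by (intro mult_left_mono)
  moreover have "k * (x - u)\<^sup>2 \<le> 1 * (x - u)\<^sup>2" using k by (intro mult_right_mono) auto
  moreover have "0 \<le> (x - u)\<^sup>2 * (k * u\<^sup>2)" using k by auto
  ultimately have "1 + k * x\<^sup>2 \<le> 2 * (1 + (x - u)\<^sup>2) * (1 + k * u\<^sup>2)"
    by (simp add: algebra_simps)
  then have "inverse (1 + k * u\<^sup>2) \<le> 2 * (1 + (x - u)\<^sup>2) * inverse (1 + k * x\<^sup>2)"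
    using p by (simp add: divide_simps mult.commute)
  then have "lam1 / pi * inverse (1 + k * u\<^sup>2) \<le> lam1 / pi * (2 * (1 + (x - u)\<^sup>2) * inverse (1 + k * x\<^sup>2))"
    by (intro mult_left_mono) (auto simp: lam1_def)
  then show ?thesis
    by (simp add: gamma1_def k_def mult_ac)
qed

lemma g1_le_gamma1: "g1 x \<le> 4 * gamma1 x"
proof (rule has_bochner_integral_mono[OF has_bochner_integral_g1])
  have "has_bochner_integral lborel (\<lambda>u. 2 * gamma1 x * (phi (x - u) + (x - u)\<^sup>2 * phi (x - u)))
      (2 * gamma1 x * (1 + 1))"
    by (intro has_bochner_integral_mult_right has_bochner_integral_add has_bochner_integral_phi_moments)
  then show "has_bochner_integral lborel (\<lambda>u. 2 * gamma1 x * (phi (x - u) + (x - u)\<^sup>2 * phi (x - u)))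
      (4 * gamma1 x)" by simp
  show "phi (x - u) * gamma1 u \<le> 2 * gamma1 x * (phi (x - u) + (x - u)\<^sup>2 * phi (x - u))" for u
    using mult_left_mono[OF gamma1_peetre[of u x] less_imp_le[OF phi_pos[of "x - u"]]]
    by (simp add: algebra_simps)
qed

text \<open>The factor \<open>3 - v\<^sup>2\<close> is the tangent of \<open>4 / (1 + v\<^sup>2)\<close> in the variable \<open>v\<^sup>2\<close>
  at the mean \<open>1\<close>.\<close>

lemma gamma1_le_g1: "gamma1 x \<le> 4 * g1 x"
proof -
  have "1/4 * gamma1 x \<le> g1 x"
  proof (rule has_bochner_integral_mono[OF _ has_bochner_integral_g1])
    have "has_bochner_integral lborel (\<lambda>u. gamma1 x / 8 * (3 * phi (x - u) - (x - u)\<^sup>2 * phi (x - u)))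
        (gamma1 x / 8 * (3 * 1 - 1))"
      by (intro has_bochner_integral_mult_right has_bochner_integral_diff has_bochner_integral_phi_moments)
    then show "has_bochner_integral lborel (\<lambda>u. gamma1 x / 8 * (3 * phi (x - u) - (x - u)\<^sup>2 * phi (x - u)))
        (1/4 * gamma1 x)" by simp
    fix u
    define v where "v = (x - u)\<^sup>2"
    have v: "0 \<le> v" by (simp add: v_def)
    have 1: "gamma1 x \<le> 2 * (1 + v) * gamma1 u"
      using gamma1_peetre[of x u] by (simp add: v_def power2_commute)
    have "(3 - v) * gamma1 x \<le> 8 * gamma1 u"
    proof (cases "v \<le> 3")
      case True
      have "(3 - v) * gamma1 x \<le> (3 - v) * (2 * (1 + v) * gamma1 u)"
        using True by (intro mult_left_mono 1) auto
      also have "\<dots> = (8 - 2 * (v - 1)\<^sup>2) * gamma1 u"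
        by (simp add: power2_eq_square algebra_simps)
      also have "\<dots> \<le> 8 * gamma1 u"
        using gamma1_pos[of u] by (intro mult_right_mono) auto
      finally show ?thesis .
    next
      case False
      then have "(3 - v) * gamma1 x \<le> 0"
        using gamma1_pos[of x] by (intro mult_nonpos_nonneg) auto
      then show ?thesis using gamma1_pos[of u] by simp
    qed
    from mult_left_mono[OF this less_imp_le[OF phi_pos[of "x - u"]]]
    show "gamma1 x / 8 * (3 * phi (x - u) - (x - u)\<^sup>2 * phi (x - u)) \<le> phi (x - u) * gamma1 u"
      by (simp add: v_def algebra_simps)
  qed
  then show ?thesis by simp
qed

lemma g1_pos: "0 < g1 x"
  using gamma1_le_g1[of x] gamma1_pos[of x] by linarith

lemma g1_upper: "(1 + x\<^sup>2) * g1 x \<le> 28"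
proof -
  \<comment> \<open>The factor 20 is \<open>1 / lam1\<close>, for which the coefficients of x^2
    agree; then 20 < 7 pi.\<close>
  have "lam1 * (1 + x\<^sup>2) \<le> 20 * (1 + lam1\<^sup>2 * x\<^sup>2)"
    by (simp add: lam1_def power2_eq_square field_simps)
  also have "\<dots> \<le> 7 * pi * (1 + lam1\<^sup>2 * x\<^sup>2)"
    using pi_gt3 by (intro mult_right_mono) auto
  finally have "(1 + x\<^sup>2) * gamma1 x \<le> 7"
    by (simp add: gamma1_def divide_simps add_pos_nonneg mult_ac add_nonneg_eq_0_iff)
  moreover have "(1 + x\<^sup>2) * g1 x \<le> (1 + x\<^sup>2) * (4 * gamma1 x)"
    by (intro mult_left_mono g1_le_gamma1) auto
  ultimately show ?thesis by simp
qed

lemma g1_lower: "3 / 1000 \<le> (1 + x\<^sup>2) * g1 x"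
proof -
  have "1 + lam1\<^sup>2 * x\<^sup>2 \<le> 1 + x\<^sup>2"
    by (simp add: lam1_def power2_eq_square field_simps)
  \<comment> \<open>With pi < 4 the product 0.012 pi stays below \<open>lam1\<close> = 0.05.
    Dividing 12/1000 by the 4 from \<open>gamma1_le_g1\<close> gives 3/1000.\<close>
  then have "12 / 1000 * pi * (1 + lam1\<^sup>2 * x\<^sup>2) \<le> lam1 * (1 + x\<^sup>2)"
    using pi_less_4 by (intro mult_mono) (auto simp: lam1_def)
  then have "12 / 1000 \<le> (1 + x\<^sup>2) * gamma1 x"
    by (simp add: gamma1_def divide_simps add_pos_nonneg mult_ac add_nonneg_eq_0_iff)
  moreover have "(1 + x\<^sup>2) * gamma1 x \<le> (1 + x\<^sup>2) * (4 * g1 x)"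
    by (intro mult_left_mono gamma1_le_g1) auto
  ultimately show ?thesis by simp
qed

section \<open>Tail of the spike marginal\<close>

text \<open>The convolution is split at |u| = |x|/2. For smaller u the normal factor is at most
  \<open>phi (x / 2)\<close>; for larger u the Laplace factor is at most its value at |x|/2, and the
  normal factor integrates to 1.\<close>

lemma g0_le_split:
  assumes "1 \<le> n"
  shows "g0 n x \<le> phi (x / 2) + lam0 n / 2 * exp (- lam0 n * \<bar>x\<bar> / 2)"
proof (rule has_bochner_integral_mono[OF has_bochner_integral_g0[OF assms]])
  let ?B = "lam0 n / 2 * exp (- lam0 n * \<bar>x\<bar> / 2)"
  have "has_bochner_integral lborel (\<lambda>u. phi (x / 2) * gamma0 n u + ?B * phi (x - u)) (phi (x / 2) * 1 + ?B * 1)"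
    unfolding gamma0_eq using has_bochner_integral_laplace_density[OF lam0_pos[OF assms]]
    by (intro has_bochner_integral_mult_right has_bochner_integral_add has_bochner_integral_phi_moments)
  then show "has_bochner_integral lborel (\<lambda>u. phi (x / 2) * gamma0 n u + ?B * phi (x - u)) (phi (x / 2) + ?B)"
    by simp
  fix u
  have l: "0 < lam0 n" by (rule lam0_pos[OF assms])
  show "phi (x - u) * gamma0 n u \<le> phi (x / 2) * gamma0 n u + ?B * phi (x - u)"
  proof (cases "\<bar>u\<bar> \<le> \<bar>x\<bar> / 2")
    case True
    then have "(x / 2)\<^sup>2 \<le> (x - u)\<^sup>2"
      by (intro abs_le_square_iff[THEN iffD1]) linarith
    then have "phi (x - u) \<le> phi (x / 2)"
      by (simp add: phi_def std_normal_density_def divide_right_mono)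
    then have "phi (x - u) * gamma0 n u \<le> phi (x / 2) * gamma0 n u"
      using gamma0_pos[OF assms, of u] by (intro mult_right_mono) auto
    moreover have "0 \<le> ?B * phi (x - u)" using l phi_pos[of "x - u"] by simp
    ultimately show ?thesis by linarith
  next
    case False
    then have "lam0 n * (\<bar>x\<bar> / 2) \<le> lam0 n * \<bar>u\<bar>"
      using l by (intro mult_left_mono) auto
    then have "gamma0 n u \<le> ?B"
      using l by (simp add: gamma0_def)
    then have "phi (x - u) * gamma0 n u \<le> phi (x - u) * ?B"
      using phi_pos[of "x - u"] by (intro mult_left_mono) auto
    moreover have "0 \<le> phi (x / 2) * gamma0 n u"
      using phi_pos[of "x / 2"] gamma0_pos[OF assms, of u] by simp
    ultimately show ?thesis by (simp add: mult.commute)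
  qed
qed

text \<open>The sixth power is enough to absorb, in \<open>g0_tail\<close>, the growth x^4 and the
  factors \<open>n\<close> and \<open>lam0 n\<close>, with negative powers of n and x left
  over.\<close>

lemma exp_minus_le_power6:
  fixes y :: real
  assumes "0 < y"
  shows "exp (- y) \<le> (6 / y) ^ 6"
proof -
  have "(y / 6) ^ 6 \<le> exp (y / 6) ^ 6"
    using assms exp_ge_add_one_self[of "y / 6"] by (intro power_mono) linarith+
  also have "\<dots> = exp y" by (simp add: exp_of_nat_mult[symmetric])
  finally show ?thesis
    using assms by (simp add: exp_minus power_divide field_simps)
qed

lemma ln_ge_1: "400000 \<le> n \<Longrightarrow> 1 \<le> ln (real n)"
  using exp_le by (subst ln_ge_iff) auto

text \<open>Beyond c sqrt(log n), Gaussian decay becomes the power n^(-d c^2). It is used with c =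
  6, d = 1/16 and with c = 2, d = 1/4.\<close>

lemma exp_minus_square_le:
  assumes "400000 \<le> n" "c * sqrt (ln (real n)) \<le> \<bar>x\<bar>" "0 \<le> c" "0 \<le> d"
  shows "exp (- (d * x\<^sup>2)) \<le> exp (- (d * c\<^sup>2 * ln (real n)))"
proof -
  have "(c * sqrt (ln (real n)))\<^sup>2 \<le> \<bar>x\<bar>\<^sup>2"
    using assms ln_ge_1[OF assms(1)] by (intro power_mono) auto
  then have "c\<^sup>2 * ln (real n) \<le> x\<^sup>2"
    using ln_ge_1[OF assms(1)] by (simp add: power_mult_distrib)
  from mult_left_mono[OF this assms(4)] show ?thesis
    by (simp add: mult.assoc)
qed

text \<open>Of the two terms bounding \<open>g0\<close>, the first has Gaussian decay and the second decays
  exponentially at rate \<open>n\<close>, against the polynomial decay of \<open>g1\<close>.\<close>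

lemma g0_tail:
  assumes n: "400000 \<le> n" and x: "6 * sqrt (ln (real n)) \<le> \<bar>x\<bar>"
  shows "(1 + x\<^sup>2) * (real n * g0 n x) \<le> g1 x"
proof -
  have n1: "1 \<le> n" and rn: "400000 \<le> real n" using n by auto
  define l where "l = lam0 n"
  have l: "5 * real n \<le> l" unfolding l_def by (rule lam0_ge[OF n1])
  have L: "1 \<le> ln (real n)" by (rule ln_ge_1[OF n])
  then have x6: "6 \<le> \<bar>x\<bar>" using x by (smt (verit) real_sqrt_ge_one)
  have "6\<^sup>2 \<le> \<bar>x\<bar>\<^sup>2" using x6 by (intro power_mono) auto
  then have xx: "36 \<le> x\<^sup>2" by simp
  have one: "(1 + x\<^sup>2)\<^sup>2 * (real n * phi (x / 2)) \<le> 1024 / real n"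
  proof -
    \<comment> \<open>Squared, this costs exp(x^2/16), half of the decay exp(-x^2/8) of
      \<open>phi (x / 2)\<close>. The other half is at most n^(-36/16) beyond the threshold, hence
      at most n^(-2).\<close>
    have e: "1 + x\<^sup>2 \<le> 32 * exp (x\<^sup>2 / 32)"
      using exp_ge_add_one_self[of "x\<^sup>2 / 32"] by linarith
    have "(1 + x\<^sup>2)\<^sup>2 \<le> (32 * exp (x\<^sup>2 / 32))\<^sup>2"
      using e by (intro power_mono) auto
    also have "\<dots> = 1024 * exp (1/16 * x\<^sup>2)"
      by (simp add: power_mult_distrib exp_double[symmetric])
    finally have 1: "(1 + x\<^sup>2)\<^sup>2 \<le> 1024 * exp (1/16 * x\<^sup>2)" .
    have 2: "phi (x / 2) \<le> exp (- (1/8 * x\<^sup>2))"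
      using one_le_sqrt_2pi
      by (simp add: phi_def std_normal_density_def power_divide divide_le_eq mult_le_cancel_left1)
    have "exp (- (1/16 * x\<^sup>2)) \<le> exp (- (1/16 * 6\<^sup>2 * ln (real n)))"
      by (rule exp_minus_square_le[OF n x]) auto
    also have "\<dots> \<le> exp (- (2 * ln (real n)))"
      using L by simp
    also have "\<dots> = inverse ((real n)\<^sup>2)"
      using rn by (simp add: exp_minus exp_double)
    finally have 3: "exp (- (1/16 * x\<^sup>2)) \<le> inverse ((real n)\<^sup>2)" .
    have "(1 + x\<^sup>2)\<^sup>2 * (real n * phi (x / 2)) \<le> (1024 * exp (1/16 * x\<^sup>2)) * (real n * exp (- (1/8 * x\<^sup>2)))"
      using phi_pos[of "x / 2"] by (intro mult_mono 1 2) auto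
    also have "\<dots> = 1024 * real n * exp (- (1/16 * x\<^sup>2))"
      by (simp add: exp_add[symmetric])
    also have "\<dots> \<le> 1024 * real n * inverse ((real n)\<^sup>2)"
      by (intro mult_left_mono 3) auto
    also have "\<dots> = 1024 / real n"
      using rn by (simp add: power2_eq_square field_simps)
    finally show ?thesis .
  qed
  have two: "(1 + x\<^sup>2)\<^sup>2 * (real n * (l / 2 * exp (- l * \<bar>x\<bar> / 2))) \<le> 54 / real n"
  proof -
    have lx: "0 < l * \<bar>x\<bar> / 2" using l rn x6 by auto
    have "(1 + x\<^sup>2)\<^sup>2 \<le> (2 * x\<^sup>2)\<^sup>2" using xx by (intro power_mono) auto
    then have 1: "(1 + x\<^sup>2)\<^sup>2 \<le> 4 * x ^ 4" by (simp add: power_mult_distrib)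
    have "exp (- l * \<bar>x\<bar> / 2) \<le> (6 / (l * \<bar>x\<bar> / 2)) ^ 6"
      using exp_minus_le_power6[OF lx] by simp
    also have "\<dots> = 12 ^ 6 / (l ^ 6 * x ^ 6)"
      by (simp add: power_divide power_mult_distrib)
    finally have 2: "exp (- l * \<bar>x\<bar> / 2) \<le> 12 ^ 6 / (l ^ 6 * x ^ 6)" .
    have "(1 + x\<^sup>2)\<^sup>2 * (real n * (l / 2 * exp (- l * \<bar>x\<bar> / 2)))
        \<le> (4 * x ^ 4) * (real n * (l / 2 * (12 ^ 6 / (l ^ 6 * x ^ 6))))"
      using l rn by (intro mult_mono 1 2 mult_left_mono) auto
    also have "\<dots> = 2 * 12 ^ 6 * real n / (l ^ 5 * x\<^sup>2)"
    proof -
      have "l ^ 6 = l * l ^ 5" "x ^ 6 = x ^ 4 * x\<^sup>2"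
        by (simp_all flip: power_Suc power_add)
      moreover have "l \<noteq> 0" "x \<noteq> 0" using l rn x6 by auto
      ultimately show ?thesis by (simp add: divide_simps)
    qed
    also have "\<dots> \<le> 2 * 12 ^ 6 * real n / ((5 * real n) ^ 5 * 36)"
      using l rn xx by (intro divide_left_mono mult_mono power_mono mult_pos_pos) auto
    also have "\<dots> \<le> 54 / real n ^ 4"
    proof -
      have "(5 * real n) ^ 5 = 3125 * (real n * real n ^ 4)"
        by (simp add: power_mult_distrib flip: power_Suc)
      with rn show ?thesis by (simp add: divide_simps)
    qed
    also have "\<dots> \<le> 54 / real n"
      using rn self_le_power[of "real n" 4] by (intro divide_left_mono) auto
    finally show ?thesis .
  qed
  \<comment> \<open>The claim is proved after multiplication by 1 + x^2, so that
    \<open>g1_lower\<close> bounds the right side below by a constant.\<close>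
  have "(1 + x\<^sup>2)\<^sup>2 * (real n * g0 n x) \<le> (1 + x\<^sup>2)\<^sup>2 * (real n * (phi (x / 2) + l / 2 * exp (- l * \<bar>x\<bar> / 2)))"
    using g0_le_split[OF n1, of x] unfolding l_def by (intro mult_left_mono) auto
  also have "\<dots> \<le> 1024 / real n + 54 / real n"
    using add_mono[OF one two] by (simp add: algebra_simps)
  \<comment> \<open>The threshold 400000 comes from here: 1078 / n has to be at most 3/1000.\<close>
  also have "\<dots> \<le> 3 / 1000"
    using rn by (simp add: field_simps)
  also have "\<dots> \<le> (1 + x\<^sup>2) * g1 x" by (rule g1_lower)
  finally have "(1 + x\<^sup>2) * ((1 + x\<^sup>2) * (real n * g0 n x)) \<le> (1 + x\<^sup>2) * g1 x"
    by (simp add: power2_eq_square mult.assoc)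
  then show ?thesis
    by (rule mult_left_le_imp_le) (simp add: add_pos_nonneg)
qed

section \<open>Unnormalised second moments under spike and slab\<close>

text \<open>The split is at |u| = 4|x|. Inside, u^2 is at most 16 x^2. Outside, the tilting exponent
  is at most -u^2/4, so u^2 \<open>phi (x - u)\<close> is at most 4 \<open>phi x\<close>, hence at
  most 8 \<open>g0 n x\<close>. Providing a dominating function with known integral lets such bounds
  be added and rescaled without treating the integrability of the second moment itself.\<close>

lemma spike_second_moment_dominated:
  assumes n: "1 \<le> n"
  obtains h where "has_bochner_integral lborel h ((16 * x\<^sup>2 + 8) * g0 n x)"
    "\<And>u. u\<^sup>2 * (phi (x - u) * gamma0 n u) \<le> h u"
proof
  \<comment> \<open>This equals \<open>8 * g0 n x\<close>, written so that the two integrals add up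
    to the stated total by cancellation.\<close>
  let ?c = "(16 * x\<^sup>2 + 8) * g0 n x - 16 * x\<^sup>2 * g0 n x"
  let ?h = "\<lambda>u. 16 * x\<^sup>2 * (phi (x - u) * gamma0 n u) + ?c * gamma0 n u"
  have "has_bochner_integral lborel ?h (16 * x\<^sup>2 * g0 n x + ?c * 1)"
    using has_bochner_integral_laplace_density[OF lam0_pos[OF n]]
    by (intro has_bochner_integral_add has_bochner_integral_mult_right has_bochner_integral_g0[OF n])
       (simp add: gamma0_eq)
  then show "has_bochner_integral lborel ?h ((16 * x\<^sup>2 + 8) * g0 n x)" by simp
  fix u
  have c: "4 * phi x \<le> ?c" using phi_le_g0(2)[OF n, of x] by (simp add: algebra_simps)
  have g: "0 < gamma0 n u" by (rule gamma0_pos[OF n])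
  have p: "0 < phi (x - u)" by (rule phi_pos)
  show "u\<^sup>2 * (phi (x - u) * gamma0 n u) \<le> ?h u"
  proof (cases "\<bar>u\<bar> \<le> 4 * \<bar>x\<bar>")
    case True
    then have "\<bar>u\<bar>\<^sup>2 \<le> (4 * \<bar>x\<bar>)\<^sup>2" by (intro power_mono) auto
    then have "u\<^sup>2 \<le> 16 * x\<^sup>2" by (simp add: power_mult_distrib)
    then have "u\<^sup>2 * (phi (x - u) * gamma0 n u) \<le> 16 * x\<^sup>2 * (phi (x - u) * gamma0 n u)"
      using g p by (intro mult_right_mono) auto
    moreover have "0 \<le> ?c * gamma0 n u" using c phi_pos[of x] g by (intro mult_nonneg_nonneg) linarith+
    ultimately show ?thesis by linarith
  next
    case False
    have "x * u \<le> \<bar>x\<bar> * \<bar>u\<bar>" by (metis abs_ge_self abs_mult)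
    also have "\<dots> \<le> (\<bar>u\<bar> / 4) * \<bar>u\<bar>" using False by (intro mult_right_mono) auto
    finally have "x * u - u\<^sup>2 / 2 \<le> - (u\<^sup>2 / 4)" by (simp add: power2_eq_square)
    then have "phi (x - u) \<le> phi x * exp (- (u\<^sup>2 / 4))"
      unfolding phi_diff using phi_pos[of x] by (intro mult_left_mono) auto
    then have "u\<^sup>2 * phi (x - u) \<le> u\<^sup>2 * (phi x * exp (- (u\<^sup>2 / 4)))"
      by (intro mult_left_mono) auto
    also have "\<dots> = 4 * phi x * (u\<^sup>2 / 4 * exp (- (u\<^sup>2 / 4)))" by simp
    also have "\<dots> \<le> 4 * phi x * 1"
    proof (intro mult_left_mono)
      have "u\<^sup>2 / 4 \<le> exp (u\<^sup>2 / 4)" using exp_ge_add_one_self[of "u\<^sup>2 / 4"] by linarith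
      then show "u\<^sup>2 / 4 * exp (- (u\<^sup>2 / 4)) \<le> 1" by (simp add: exp_minus divide_simps)
    qed (use phi_pos[of x] in auto)
    finally have "u\<^sup>2 * phi (x - u) \<le> ?c" using c by linarith
    then have "u\<^sup>2 * phi (x - u) * gamma0 n u \<le> ?c * gamma0 n u"
      using g by (intro mult_right_mono) auto
    moreover have "0 \<le> 16 * x\<^sup>2 * (phi (x - u) * gamma0 n u)" using g p by simp
    ultimately show ?thesis unfolding mult.assoc[of "u\<^sup>2", symmetric] by (rule order_trans[OF _ add_increasing[OF _ order_refl]])
  qed
qed

text \<open>Summed over up to n null coordinates, the spike part must stay bounded in mean, hence
  the factor 1/n. For |x| at most half the rate l, tilting costs at most exp(l|u|/2), which turns
  the spike into twice a Laplace density of rate l/2 with second moment 8/l^2. For larger |x| the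
  previous bound suffices, since 4 x^2/l^2 is then at least 1.\<close>

lemma spike_second_moment_small:
  assumes n: "1 \<le> n"
  obtains h where "has_bochner_integral lborel h (96 * (1 + x ^ 4) / real n * g0 n x)"
    "\<And>u. u\<^sup>2 * (phi (x - u) * gamma0 n u) \<le> h u"
proof -
  define l where "l = lam0 n"
  have rn: "1 \<le> real n" using n by simp
  have l: "0 < l" "5 * real n \<le> l" unfolding l_def using lam0_pos[OF n] lam0_ge[OF n] by auto
  have "real n * 1 \<le> l * l" using l rn by (intro mult_mono) auto
  then have nl: "real n \<le> l\<^sup>2" by (simp add: power2_eq_square)
  have g: "0 < g0 n x" by (rule g0_pos[OF n])
  have "\<exists>h B. has_bochner_integral lborel h (B * g0 n x) \<and> B \<le> 96 * (1 + x ^ 4) / real n \<and>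
      (\<forall>u. u\<^sup>2 * (phi (x - u) * gamma0 n u) \<le> h u)"
  proof (cases "\<bar>x\<bar> \<le> l / 2")
    case True
    let ?h = "\<lambda>u. 2 * phi x * (u ^ 2 * laplace_density (l / 2) u)"
    have "has_bochner_integral lborel ?h (2 * phi x * (fact 2 / (l / 2) ^ 2))"
      using l by (intro has_bochner_integral_mult_right has_bochner_integral_laplace_even) auto
    then have "has_bochner_integral lborel ?h ((16 * phi x / (l\<^sup>2 * g0 n x)) * g0 n x)"
      using g by (simp add: power_divide)
    moreover have "16 * phi x / (l\<^sup>2 * g0 n x) \<le> 96 * (1 + x ^ 4) / real n"
    proof -
      have "16 * phi x / (l\<^sup>2 * g0 n x) \<le> 32 / l\<^sup>2"
        using phi_le_g0(2)[OF n, of x] g l by (simp add: divide_simps)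
      also have "\<dots> \<le> 32 / real n" using nl rn l by (intro divide_left_mono) auto
      also have "\<dots> \<le> 96 * (1 + x ^ 4) / real n" by (intro divide_right_mono) auto
      finally show ?thesis .
    qed
    moreover have "u\<^sup>2 * (phi (x - u) * gamma0 n u) \<le> ?h u" for u
    proof -
      have "x * u \<le> \<bar>x\<bar> * \<bar>u\<bar>" by (metis abs_ge_self abs_mult)
      also have "\<dots> \<le> l / 2 * \<bar>u\<bar>" using True by (intro mult_right_mono) auto
      finally have "exp (x * u - u\<^sup>2 / 2) \<le> exp (l / 2 * \<bar>u\<bar>)"
        by (smt (verit) exp_le_cancel_iff zero_le_power2 divide_nonneg_nonneg)
      then have "phi (x - u) \<le> phi x * exp (l / 2 * \<bar>u\<bar>)"
        unfolding phi_diff using phi_pos[of x] by (intro mult_left_mono) auto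
      then have "u\<^sup>2 * (phi (x - u) * gamma0 n u) \<le> u\<^sup>2 * ((phi x * exp (l / 2 * \<bar>u\<bar>)) * gamma0 n u)"
        using gamma0_pos[OF n, of u] by (intro mult_left_mono mult_right_mono) auto
      also have "exp (l / 2 * \<bar>u\<bar>) * gamma0 n u = 2 * laplace_density (l / 2) u"
        by (simp add: gamma0_def laplace_density_def l_def[symmetric] exp_add[symmetric] field_simps)
      then have "u\<^sup>2 * ((phi x * exp (l / 2 * \<bar>u\<bar>)) * gamma0 n u) = ?h u"
        by (simp add: mult_ac)
      finally show ?thesis .
    qed
    ultimately show ?thesis by blast
  next
    case False
    have "1 \<le> 4 * x\<^sup>2 / l\<^sup>2"
    proof -
      have "(l / 2)\<^sup>2 \<le> \<bar>x\<bar>\<^sup>2" using False l by (intro power_mono) auto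
      then show ?thesis using l by (simp add: power_divide)
    qed
    then have "(16 * x\<^sup>2 + 8) * 1 \<le> (16 * x\<^sup>2 + 8) * (4 * x\<^sup>2 / l\<^sup>2)"
      by (intro mult_left_mono) auto
    also have "\<dots> = (64 * x ^ 4 + 32 * x\<^sup>2) / l\<^sup>2"
      by (simp add: field_simps eval_nat_numeral)
    also have "\<dots> \<le> (64 * x ^ 4 + 32 * x\<^sup>2) / real n"
      using nl rn l by (intro divide_left_mono) auto
    also have "\<dots> \<le> 96 * (1 + x ^ 4) / real n"
    proof -
      have "2 * x\<^sup>2 \<le> 1 + x ^ 4"
        using zero_le_power2[of "x\<^sup>2 - 1"] by (simp add: power2_eq_square eval_nat_numeral algebra_simps)
      moreover have "64 * y + 32 * z \<le> 96 * (1 + y)" if "2 * z \<le> 1 + y" "0 \<le> y" for y z :: real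
        using that by simp
      ultimately have "64 * x ^ 4 + 32 * x\<^sup>2 \<le> 96 * (1 + x ^ 4)"
        using zero_le_power2[of "x\<^sup>2"] by (metis power_mult num_double numeral_times_numeral)
      then show ?thesis by (intro divide_right_mono) auto
    qed
    finally have B: "16 * x\<^sup>2 + 8 \<le> 96 * (1 + x ^ 4) / real n" by simp
    obtain h where "has_bochner_integral lborel h ((16 * x\<^sup>2 + 8) * g0 n x)"
      "\<And>u. u\<^sup>2 * (phi (x - u) * gamma0 n u) \<le> h u"
      by (rule spike_second_moment_dominated[OF n]) blast
    with B show ?thesis by blast
  qed
  then obtain h B where h: "has_bochner_integral lborel h (B * g0 n x)" "B \<le> 96 * (1 + x ^ 4) / real n"
      "\<And>u. u\<^sup>2 * (phi (x - u) * gamma0 n u) \<le> h u"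
    by blast
  \<comment> \<open>The slack in B is filled with a multiple of the integrand of \<open>g0\<close>,
    because the conclusion prescribes the exact integral.\<close>
  let ?c = "96 * (1 + x ^ 4) / real n - B"
  have "has_bochner_integral lborel (\<lambda>u. h u + ?c * (phi (x - u) * gamma0 n u)) (B * g0 n x + ?c * g0 n x)"
    by (intro has_bochner_integral_add has_bochner_integral_mult_right has_bochner_integral_g0[OF n] h)
  moreover have "B * g0 n x + ?c * g0 n x = 96 * (1 + x ^ 4) / real n * g0 n x"
    by (simp add: algebra_simps)
  moreover have "u\<^sup>2 * (phi (x - u) * gamma0 n u) \<le> h u + ?c * (phi (x - u) * gamma0 n u)" for u
    using h(3)[of u] h(2) phi_pos[of "x - u"] gamma0_pos[OF n, of u] by (simp add: add_increasing2)
  ultimately show ?thesis using that by simp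
qed

text \<open>The deviation u - m is split at the observation x. The Peetre inequality replaces
  \<open>gamma1 u\<close> by a multiple of \<open>g1 x\<close>, and the normal moments 1 and 3 give
  16 * 4 = 64. The centre m is 0 for nulls and the true mean for signals.\<close>

lemma slab_second_moment_dominated:
  obtains h where "has_bochner_integral lborel h ((2 * (x - m)\<^sup>2 + 64) * g1 x)"
    "\<And>u. (u - m)\<^sup>2 * (phi (x - u) * gamma1 u) \<le> h u"
proof
  let ?c = "4 * g1 x"
  let ?h = "\<lambda>u. 2 * (x - m)\<^sup>2 * (phi (x - u) * gamma1 u)
    + 4 * ?c * ((x - u)\<^sup>2 * phi (x - u) + (x - u) ^ 4 * phi (x - u))"
  have "has_bochner_integral lborel ?h (2 * (x - m)\<^sup>2 * g1 x + 4 * ?c * (1 + 3))"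
    by (intro has_bochner_integral_add has_bochner_integral_mult_right has_bochner_integral_g1
        has_bochner_integral_phi_moments)
  then show "has_bochner_integral lborel ?h ((2 * (x - m)\<^sup>2 + 64) * g1 x)"
    by (simp add: algebra_simps)
  fix u
  have p: "0 < phi (x - u)" by (rule phi_pos)
  have "(u - m)\<^sup>2 \<le> 2 * (x - m)\<^sup>2 + 2 * (x - u)\<^sup>2"
    using zero_le_power2[of "(x - m) + (x - u)"] by (simp add: power2_eq_square algebra_simps)
  then have "(u - m)\<^sup>2 * (phi (x - u) * gamma1 u) \<le> (2 * (x - m)\<^sup>2 + 2 * (x - u)\<^sup>2) * (phi (x - u) * gamma1 u)"
    using p gamma1_pos[of u] by (intro mult_right_mono) auto
  also have "\<dots> = 2 * (x - m)\<^sup>2 * (phi (x - u) * gamma1 u) + 2 * (x - u)\<^sup>2 * phi (x - u) * gamma1 u"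
    by (simp add: algebra_simps)
  also have "2 * (x - u)\<^sup>2 * phi (x - u) * gamma1 u
      \<le> 2 * (x - u)\<^sup>2 * phi (x - u) * (2 * (1 + (x - u)\<^sup>2) * ?c)"
  proof (intro mult_left_mono)
    have "2 * (1 + (x - u)\<^sup>2) * gamma1 x \<le> 2 * (1 + (x - u)\<^sup>2) * ?c"
      by (intro mult_left_mono gamma1_le_g1) auto
    with gamma1_peetre[of u x] show "gamma1 u \<le> 2 * (1 + (x - u)\<^sup>2) * ?c" by linarith
  qed (use p in auto)
  also have "\<dots> = 4 * ?c * ((x - u)\<^sup>2 * phi (x - u) + (x - u) ^ 4 * phi (x - u))"
  proof -
    have "(x - u) ^ 4 = (x - u)\<^sup>2 * (x - u)\<^sup>2" by (simp flip: power_add)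
    then show ?thesis by (simp add: algebra_simps)
  qed
  finally show "(u - m)\<^sup>2 * (phi (x - u) * gamma1 u) \<le> ?h u" by simp
qed

subsection \<open>Posterior moments of one coordinate\<close>

text \<open>This is the marginal density of one observation at weight \<open>\<alpha>\<close>. It is
  affine in the weight, which makes the log-likelihood concave.\<close>

definition mixture :: "nat \<Rightarrow> real \<Rightarrow> real \<Rightarrow> real" where
  "mixture n \<alpha> x = (1 - \<alpha>) * g0 n x + \<alpha> * g1 x"

lemma borel_measurable_mixture [measurable]: "mixture n \<alpha> \<in> borel_measurable borel"
  unfolding mixture_def by measurable

lemma mixture_pos: "1 \<le> n \<Longrightarrow> 0 \<le> \<alpha> \<Longrightarrow> \<alpha> \<le> 1 \<Longrightarrow> 0 < mixture n \<alpha> x"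
  unfolding mixture_def using g0_pos[of n x] g1_pos[of x]
  by (cases "\<alpha> = 0") (auto intro!: add_nonneg_pos)

lemma post_a_eq: "post_a n \<alpha> x = \<alpha> * g1 x / mixture n \<alpha> x"
  by (simp add: post_a_def mixture_def)

lemma one_minus_post_a:
  assumes "1 \<le> n" "0 \<le> \<alpha>" "\<alpha> \<le> 1"
  shows "1 - post_a n \<alpha> x = (1 - \<alpha>) * g0 n x / mixture n \<alpha> x"
proof -
  have "mixture n \<alpha> x \<noteq> 0" using mixture_pos[OF assms, of x] by simp
  then have "1 - post_a n \<alpha> x = (mixture n \<alpha> x - \<alpha> * g1 x) / mixture n \<alpha> x"
    by (simp add: post_a_eq diff_divide_distrib)
  then show ?thesis by (simp add: mixture_def)
qed

lemma post_a_bounds: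
  assumes "1 \<le> n" "0 \<le> \<alpha>" "\<alpha> \<le> 1"
  shows "0 \<le> post_a n \<alpha> x" "post_a n \<alpha> x \<le> 1"
proof -
  show "0 \<le> post_a n \<alpha> x"
    unfolding post_a_eq using mixture_pos[OF assms, of x] g1_pos[of x] assms by simp
  have "0 \<le> 1 - post_a n \<alpha> x"
    unfolding one_minus_post_a[OF assms] using mixture_pos[OF assms, of x] g0_pos[OF assms(1), of x] assms
    by simp
  then show "post_a n \<alpha> x \<le> 1" by simp
qed

text \<open>The mixture is at least half of \<open>g0\<close>, hence at least a quarter of
  \<open>phi\<close>, and \<open>g1_upper\<close> gives 4 * 28 = 112. The factor
  \<open>1 / phi x\<close> later cancels against the density of a null observation, so integration
  over a window of length of order sqrt(log n) yields \<open>\<beta>\<close> sqrt(log n).\<close>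

lemma post_a_le:
  assumes n: "1 \<le> n" and \<alpha>: "0 \<le> \<alpha>" "\<alpha> \<le> \<beta>" "\<beta> \<le> 1 / 2"
  shows "(1 + x\<^sup>2) * post_a n \<alpha> x \<le> 112 * \<beta> / phi x"
proof -
  have a1: "\<alpha> \<le> 1" using \<alpha> by simp
  have "1/2 * (1/2 * phi x) \<le> (1 - \<alpha>) * g0 n x"
    using \<alpha> phi_le_g0(2)[OF n, of x] phi_pos[of x] by (intro mult_mono) auto
  also have "\<dots> \<le> mixture n \<alpha> x" unfolding mixture_def using \<alpha> g1_pos[of x] by simp
  finally have "post_a n \<alpha> x \<le> \<beta> * g1 x / (phi x / 4)"
    unfolding post_a_eq using \<alpha> g1_pos[of x] phi_pos[of x] mixture_pos[OF n \<alpha>(1) a1, of x]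
    by (intro frac_le mult_right_mono) auto
  then have "(1 + x\<^sup>2) * post_a n \<alpha> x \<le> (1 + x\<^sup>2) * (\<beta> * g1 x / (phi x / 4))"
    by (intro mult_left_mono) auto
  also have "\<dots> = 4 * \<beta> / phi x * ((1 + x\<^sup>2) * g1 x)" by simp
  also have "\<dots> \<le> 4 * \<beta> / phi x * 28"
    using \<alpha> phi_pos[of x] by (intro mult_left_mono g1_upper) auto
  finally show ?thesis by simp
qed

text \<open>Beyond 6 sqrt(log n), \<open>g0_tail\<close> shows that even a slab weight 1/n leaves
  the spike a posterior weight of at most 1/(1 + x^2). Below that threshold, 1 + x^2 is itself at
  most 37 log n.\<close>

lemma spike_weight_le:
  assumes n: "400000 \<le> n" and \<alpha>: "1 / real n \<le> \<alpha>" "\<alpha> \<le> 1"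
  shows "(1 - post_a n \<alpha> x) * (1 + x\<^sup>2) \<le> 37 * ln (real n)"
proof -
  have n1: "1 \<le> n" using n by simp
  have \<alpha>0: "0 < \<alpha>" using less_le_trans[OF _ \<alpha>(1)] n1 by simp
  have L: "1 \<le> ln (real n)" by (rule ln_ge_1[OF n])
  note ab = post_a_bounds[OF n1 less_imp_le[OF \<alpha>0] \<alpha>(2), of x]
  show ?thesis
  proof (cases "6 * sqrt (ln (real n)) \<le> \<bar>x\<bar>")
    case True
    have "1 - post_a n \<alpha> x \<le> g0 n x / (1 / real n * g1 x)"
      unfolding one_minus_post_a[OF n1 less_imp_le[OF \<alpha>0] \<alpha>(2)]
    proof (rule frac_le)
      show "(1 - \<alpha>) * g0 n x \<le> g0 n x" using \<alpha>0 \<alpha>(2) g0_pos[OF n1, of x] by simp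
      have "1 / real n * g1 x \<le> \<alpha> * g1 x" using \<alpha>(1) g1_pos[of x] by (intro mult_right_mono) auto
      also have "\<dots> \<le> mixture n \<alpha> x" unfolding mixture_def using \<alpha>(2) g0_pos[OF n1, of x] by simp
      finally show "1 / real n * g1 x \<le> mixture n \<alpha> x" .
    qed (use g0_pos[OF n1, of x] g1_pos[of x] n1 in auto)
    then have "(1 - post_a n \<alpha> x) * (1 + x\<^sup>2) \<le> g0 n x / (1 / real n * g1 x) * (1 + x\<^sup>2)"
      by (intro mult_right_mono) auto
    also have "\<dots> = (1 + x\<^sup>2) * (real n * g0 n x) / g1 x" using n1 by simp
    also have "\<dots> \<le> 1" using g0_tail[OF n True] g1_pos[of x] by simp
    finally show ?thesis using L by simp
  next
    case False
    then have "\<bar>x\<bar>\<^sup>2 \<le> (6 * sqrt (ln (real n)))\<^sup>2" by (intro power_mono) auto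
    then have "x\<^sup>2 \<le> 36 * ln (real n)" using L by (simp add: power_mult_distrib)
    moreover have "(1 - post_a n \<alpha> x) * (1 + x\<^sup>2) \<le> 1 * (1 + x\<^sup>2)"
      using ab by (intro mult_right_mono) auto
    ultimately show ?thesis using L by simp
  qed
qed

lemma post_dens_nonneg:
  assumes "1 \<le> n" "0 \<le> \<alpha>" "\<alpha> \<le> 1"
  shows "0 \<le> post_dens n \<alpha> x u"
  unfolding post_dens_def
  using post_a_bounds[OF assms, of x] g0_pos[OF assms(1), of x] g1_pos[of x] phi_pos[of "x - u"]
    gamma0_pos[OF assms(1), of u] gamma1_pos[of u]
  by (intro add_nonneg_nonneg mult_nonneg_nonneg divide_nonneg_nonneg) auto

lemma borel_measurable_post_dens [measurable]:
  "post_dens n \<alpha> x \<in> borel_measurable borel"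
  unfolding post_dens_def by measurable

text \<open>Normalising by \<open>g0\<close> and \<open>g1\<close> turns the dominating functions
  into bounds on the spike and slab conditional moments, which are averaged with the posterior
  weights.\<close>

lemma post_dens_moment_le:
  assumes n: "1 \<le> n" and \<alpha>: "0 \<le> \<alpha>" "\<alpha> \<le> 1"
    and h0: "has_bochner_integral lborel h0 (B0 * g0 n x)" "\<And>u. f u * (phi (x - u) * gamma0 n u) \<le> h0 u"
    and h1: "has_bochner_integral lborel h1 (B1 * g1 x)" "\<And>u. f u * (phi (x - u) * gamma1 u) \<le> h1 u"
    and f: "\<And>u. 0 \<le> f u"
  shows "(\<integral>\<^sup>+u. ennreal (f u * post_dens n \<alpha> x u) \<partial>lborel)
    \<le> ennreal ((1 - post_a n \<alpha> x) * B0 + post_a n \<alpha> x * B1)"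
proof -
  let ?a = "post_a n \<alpha> x"
  note ab = post_a_bounds[OF n \<alpha>, of x]
  have g: "0 < g0 n x" "0 < g1 x" using g0_pos[OF n] g1_pos by auto
  let ?h = "\<lambda>u. (1 - ?a) / g0 n x * h0 u + ?a / g1 x * h1 u"
  have "has_bochner_integral lborel ?h ((1 - ?a) / g0 n x * (B0 * g0 n x) + ?a / g1 x * (B1 * g1 x))"
    by (intro has_bochner_integral_add has_bochner_integral_mult_right h0 h1)
  then have H: "has_bochner_integral lborel ?h ((1 - ?a) * B0 + ?a * B1)"
    using g by simp
  have le: "f u * post_dens n \<alpha> x u \<le> ?h u" for u
  proof -
    have "f u * post_dens n \<alpha> x u = (1 - ?a) / g0 n x * (f u * (phi (x - u) * gamma0 n u))
        + ?a / g1 x * (f u * (phi (x - u) * gamma1 u))"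
      by (simp add: post_dens_def algebra_simps)
    also have "\<dots> \<le> ?h u"
      using ab g by (intro add_mono mult_left_mono h0 h1) auto
    finally show ?thesis .
  qed
  have "0 \<le> ?h u" for u
    using le[of u] mult_nonneg_nonneg[OF f post_dens_nonneg[OF n \<alpha>]] by (meson order_trans)
  then have "(\<integral>\<^sup>+u. ennreal (?h u) \<partial>lborel) = ennreal ((1 - ?a) * B0 + ?a * B1)"
    using H by (subst nn_integral_eq_integral) (auto simp: has_bochner_integral_iff)
  moreover have "(\<integral>\<^sup>+u. ennreal (f u * post_dens n \<alpha> x u) \<partial>lborel) \<le> (\<integral>\<^sup>+u. ennreal (?h u) \<partial>lborel)"
    by (intro nn_integral_mono ennreal_leI le)
  ultimately show ?thesis by simp
qed

text \<open>The posterior is given by an explicit density, so its unit mass must be verified before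
  single coordinates can be projected out of the product.\<close>

lemma prob_space_post_dens:
  assumes n: "1 \<le> n" and \<alpha>: "0 \<le> \<alpha>" "\<alpha> \<le> 1"
  shows "prob_space (density lborel (\<lambda>u. ennreal (post_dens n \<alpha> x u)))"
proof
  let ?a = "post_a n \<alpha> x"
  have "has_bochner_integral lborel
      (\<lambda>u. (1 - ?a) / g0 n x * (phi (x - u) * gamma0 n u) + ?a / g1 x * (phi (x - u) * gamma1 u))
      ((1 - ?a) / g0 n x * g0 n x + ?a / g1 x * g1 x)"
    by (intro has_bochner_integral_add has_bochner_integral_mult_right has_bochner_integral_g0[OF n]
        has_bochner_integral_g1)
  then have "has_bochner_integral lborel (post_dens n \<alpha> x) 1"
    using g0_pos[OF n, of x] g1_pos[of x] by (simp add: post_dens_def[abs_def])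
  then have "(\<integral>\<^sup>+u. ennreal (post_dens n \<alpha> x u) \<partial>lborel) = 1"
    using post_dens_nonneg[OF n \<alpha>, of x]
    by (subst nn_integral_eq_integral) (auto simp: has_bochner_integral_iff)
  then show "emeasure (density lborel (\<lambda>u. ennreal (post_dens n \<alpha> x u)))
      (space (density lborel (\<lambda>u. ennreal (post_dens n \<alpha> x u)))) = 1"
    by (simp add: emeasure_density)
qed

section \<open>Coordinatewise posterior risk\<close>

lemma nn_integral_PiM_component:
  assumes "\<And>i. i \<in> I \<Longrightarrow> prob_space (M i)" "i \<in> I" "f \<in> borel_measurable (M i)"
  shows "(\<integral>\<^sup>+\<omega>. f (\<omega> i) \<partial>PiM I M) = (\<integral>\<^sup>+x. f x \<partial>M i)"
proof -
  have "(\<integral>\<^sup>+x. f x \<partial>M i) = (\<integral>\<^sup>+x. f x \<partial>distr (PiM I M) (M i) (\<lambda>\<omega>. \<omega> i))"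
    using distr_PiM_component[of I M i] assms by simp
  also have "\<dots> = (\<integral>\<^sup>+\<omega>. f (\<omega> i) \<partial>PiM I M)"
    using assms by (intro nn_integral_distr) auto
  finally show ?thesis by simp
qed

lemma nn_integral_posterior:
  assumes n: "1 \<le> n" and \<alpha>: "0 \<le> \<alpha>" "\<alpha> \<le> 1"
  shows "(\<integral>\<^sup>+\<theta>. ennreal (\<Sum>i<n. (\<theta> i - \<theta>0 i)\<^sup>2) \<partial>posterior n \<alpha> X)
    = (\<Sum>i<n. \<integral>\<^sup>+u. ennreal ((u - \<theta>0 i)\<^sup>2 * post_dens n \<alpha> (X i) u) \<partial>lborel)"
proof -
  let ?M = "\<lambda>i. density lborel (\<lambda>u. ennreal (post_dens n \<alpha> (X i) u))"
  have "(\<integral>\<^sup>+\<theta>. ennreal (\<Sum>i<n. (\<theta> i - \<theta>0 i)\<^sup>2) \<partial>posterior n \<alpha> X)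
      = (\<integral>\<^sup>+\<theta>. (\<Sum>i<n. ennreal ((\<theta> i - \<theta>0 i)\<^sup>2)) \<partial>PiM {..<n} ?M)"
    unfolding posterior_def by (subst sum_ennreal) auto
  also have "\<dots> = (\<Sum>i<n. \<integral>\<^sup>+\<theta>. ennreal ((\<theta> i - \<theta>0 i)\<^sup>2) \<partial>PiM {..<n} ?M)"
    by (intro nn_integral_sum) measurable
  also have "\<dots> = (\<Sum>i<n. \<integral>\<^sup>+u. ennreal ((u - \<theta>0 i)\<^sup>2) \<partial>?M i)"
    by (intro sum.cong refl nn_integral_PiM_component[where f = "\<lambda>u. ennreal ((u - _)\<^sup>2)"]
        prob_space_post_dens[OF n \<alpha>]) auto
  also have "\<dots> = (\<Sum>i<n. \<integral>\<^sup>+u. ennreal ((u - \<theta>0 i)\<^sup>2 * post_dens n \<alpha> (X i) u) \<partial>lborel)"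
    by (intro sum.cong refl, subst nn_integral_density)
       (auto simp: ennreal_mult post_dens_nonneg[OF n \<alpha>] mult.commute)
  finally show ?thesis .
qed

text \<open>The spike part is already of order 1/n, so the slab weight is what remains to be
  controlled at nulls. The form \<open>u - 0\<close> matches the general risk integrand with centre
  0.\<close>

lemma null_coordinate_le:
  assumes n: "1 \<le> n" and \<alpha>: "0 \<le> \<alpha>" "\<alpha> \<le> 1"
  shows "(\<integral>\<^sup>+u. ennreal ((u - 0)\<^sup>2 * post_dens n \<alpha> x u) \<partial>lborel)
    \<le> ennreal (96 * (1 + x ^ 4) / real n + 64 * ((1 + x\<^sup>2) * post_a n \<alpha> x))"
proof -
  note ab = post_a_bounds[OF n \<alpha>, of x]
  obtain h0 where h0: "has_bochner_integral lborel h0 (96 * (1 + x ^ 4) / real n * g0 n x)"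
    "\<And>u. u\<^sup>2 * (phi (x - u) * gamma0 n u) \<le> h0 u"
    by (rule spike_second_moment_small[OF n]) blast
  obtain h1 where h1: "has_bochner_integral lborel h1 ((2 * (x - 0)\<^sup>2 + 64) * g1 x)"
    "\<And>u. (u - 0)\<^sup>2 * (phi (x - u) * gamma1 u) \<le> h1 u"
    by (rule slab_second_moment_dominated) blast
  have "(\<integral>\<^sup>+u. ennreal ((u - 0)\<^sup>2 * post_dens n \<alpha> x u) \<partial>lborel)
      \<le> ennreal ((1 - post_a n \<alpha> x) * (96 * (1 + x ^ 4) / real n) + post_a n \<alpha> x * (2 * (x - 0)\<^sup>2 + 64))"
    using h0(2) by (intro post_dens_moment_le[OF n \<alpha> h0(1) _ h1]) auto
  also have "\<dots> \<le> ennreal (96 * (1 + x ^ 4) / real n + 64 * ((1 + x\<^sup>2) * post_a n \<alpha> x))"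
  proof (intro ennreal_leI add_mono)
    have "(1 - post_a n \<alpha> x) * (96 * (1 + x ^ 4) / real n) \<le> 1 * (96 * (1 + x ^ 4) / real n)"
      using ab by (intro mult_right_mono divide_nonneg_nonneg mult_nonneg_nonneg) auto
    then show "(1 - post_a n \<alpha> x) * (96 * (1 + x ^ 4) / real n) \<le> 96 * (1 + x ^ 4) / real n" by simp
    have "post_a n \<alpha> x * (2 * (x - 0)\<^sup>2 + 64) \<le> post_a n \<alpha> x * (64 * (1 + x\<^sup>2))"
      using ab by (intro mult_left_mono) auto
    then show "post_a n \<alpha> x * (2 * (x - 0)\<^sup>2 + 64) \<le> 64 * ((1 + x\<^sup>2) * post_a n \<alpha> x)"
      by (simp add: mult_ac)
  qed
  finally show ?thesis .
qed

lemma signal_coordinate_le: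
  assumes n: "400000 \<le> n" and \<alpha>: "1 / real n \<le> \<alpha>" "\<alpha> \<le> 1"
  shows "(\<integral>\<^sup>+u. ennreal ((u - m)\<^sup>2 * post_dens n \<alpha> x u) \<partial>lborel)
    \<le> ennreal (2 * (x - m)\<^sup>2 + 2580 * ln (real n))"
proof -
  have n1: "1 \<le> n" using n by simp
  have \<alpha>0: "0 \<le> \<alpha>" using order_trans[OF _ \<alpha>(1)] by simp
  have L: "1 \<le> ln (real n)" by (rule ln_ge_1[OF n])
  let ?a = "post_a n \<alpha> x"
  note ab = post_a_bounds[OF n1 \<alpha>0 \<alpha>(2), of x]
  \<comment> \<open>The inequality (u - m)^2 <= 2 (x - m)^2 + 4 x^2 + 4 u^2, with spike second
    moment 16 x^2 + 8, gives the coefficients 4 + 64 = 68 and 32.\<close>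
  let ?B = "2 * (x - m)\<^sup>2 + 68 * x\<^sup>2 + 32"
  obtain h where h: "has_bochner_integral lborel h ((16 * x\<^sup>2 + 8) * g0 n x)"
    "\<And>u. u\<^sup>2 * (phi (x - u) * gamma0 n u) \<le> h u"
    by (rule spike_second_moment_dominated[OF n1]) blast
  let ?h0 = "\<lambda>u. (2 * (x - m)\<^sup>2 + 4 * x\<^sup>2) * (phi (x - u) * gamma0 n u) + 4 * h u"
  have "has_bochner_integral lborel ?h0 ((2 * (x - m)\<^sup>2 + 4 * x\<^sup>2) * g0 n x + 4 * ((16 * x\<^sup>2 + 8) * g0 n x))"
    by (intro has_bochner_integral_add has_bochner_integral_mult_right has_bochner_integral_g0[OF n1] h)
  moreover have "(2 * (x - m)\<^sup>2 + 4 * x\<^sup>2) * g0 n x + 4 * ((16 * x\<^sup>2 + 8) * g0 n x) = ?B * g0 n x"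
    by (simp add: algebra_simps)
  ultimately have H0: "has_bochner_integral lborel ?h0 (?B * g0 n x)" by simp
  have H0': "(u - m)\<^sup>2 * (phi (x - u) * gamma0 n u) \<le> ?h0 u" for u
  proof -
    have "(u - m)\<^sup>2 \<le> 2 * (x - m)\<^sup>2 + 2 * (u - x)\<^sup>2"
      using zero_le_power2[of "(x - m) - (u - x)"] by (simp add: power2_eq_square algebra_simps)
    moreover have "(u - x)\<^sup>2 \<le> 2 * u\<^sup>2 + 2 * x\<^sup>2"
      using zero_le_power2[of "u + x"] by (simp add: power2_eq_square algebra_simps)
    ultimately have "(u - m)\<^sup>2 \<le> 2 * (x - m)\<^sup>2 + 4 * x\<^sup>2 + 4 * u\<^sup>2" by linarith
    then have "(u - m)\<^sup>2 * (phi (x - u) * gamma0 n u)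
        \<le> (2 * (x - m)\<^sup>2 + 4 * x\<^sup>2 + 4 * u\<^sup>2) * (phi (x - u) * gamma0 n u)"
      using phi_pos[of "x - u"] gamma0_pos[OF n1, of u] by (intro mult_right_mono) auto
    also have "\<dots> = (2 * (x - m)\<^sup>2 + 4 * x\<^sup>2) * (phi (x - u) * gamma0 n u) + 4 * (u\<^sup>2 * (phi (x - u) * gamma0 n u))"
      by (simp add: algebra_simps)
    also have "\<dots> \<le> ?h0 u" using h(2)[of u] by simp
    finally show ?thesis .
  qed
  obtain h1 where h1: "has_bochner_integral lborel h1 ((2 * (x - m)\<^sup>2 + 64) * g1 x)"
    "\<And>u. (u - m)\<^sup>2 * (phi (x - u) * gamma1 u) \<le> h1 u"
    by (rule slab_second_moment_dominated) blast
  have "(\<integral>\<^sup>+u. ennreal ((u - m)\<^sup>2 * post_dens n \<alpha> x u) \<partial>lborel)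
      \<le> ennreal ((1 - ?a) * ?B + ?a * (2 * (x - m)\<^sup>2 + 64))"
    by (intro post_dens_moment_le[OF n1 \<alpha>0 \<alpha>(2) H0 H0' h1]) auto
  also have "\<dots> \<le> ennreal (2 * (x - m)\<^sup>2 + 2580 * ln (real n))"
  proof (rule ennreal_leI)
    \<comment> \<open>Only the spike part carries x^2. It is regrouped as spike weight times 1 +
      x^2, which \<open>spike_weight_le\<close> bounds; 68 * 37 + 64 = 2580.\<close>
    have "(1 - ?a) * ?B + ?a * (2 * (x - m)\<^sup>2 + 64)
        = 2 * (x - m)\<^sup>2 + 68 * ((1 - ?a) * (1 + x\<^sup>2)) - 36 * (1 - ?a) + 64 * ?a"
      by (simp add: algebra_simps)
    also have "\<dots> \<le> 2 * (x - m)\<^sup>2 + 68 * (37 * ln (real n)) - 0 + 64 * ln (real n)"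
      using spike_weight_le[OF n \<alpha>, of x] ab L by (intro add_mono diff_mono) auto
    finally show "(1 - ?a) * ?B + ?a * (2 * (x - m)\<^sup>2 + 64) \<le> 2 * (x - m)\<^sup>2 + 2580 * ln (real n)" by simp
  qed
  finally show ?thesis .
qed

subsection \<open>The likelihood ratio bound for the empirical Bayes weight\<close>

lemma prob_space_normal_shift: "prob_space (density lborel (\<lambda>x. ennreal (normal_density m 1 x)))"
  by (rule prob_space_normal_density) simp

lemma nn_integral_data_law_component:
  assumes "i < n" and [measurable]: "f \<in> borel_measurable borel"
  shows "(\<integral>\<^sup>+X. f (X i) \<partial>data_law n \<theta>) = (\<integral>\<^sup>+x. ennreal (normal_density (\<theta> i) 1 x) * f x \<partial>lborel)"
  unfolding data_law_def using assms(1)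
  by (subst nn_integral_PiM_component) (auto simp: prob_space_normal_shift nn_integral_density)

lemma nn_integral_data_law_prod:
  assumes [measurable]: "f \<in> borel_measurable borel"
  shows "(\<integral>\<^sup>+X. (\<Prod>i<n. f (X i)) \<partial>data_law n \<theta>)
    = (\<Prod>i<n. \<integral>\<^sup>+x. ennreal (normal_density (\<theta> i) 1 x) * f x \<partial>lborel)"
proof -
  interpret product_prob_space "\<lambda>i. density lborel (\<lambda>x. ennreal (normal_density (\<theta> i) 1 x))" "{..<n}"
    by (intro product_prob_spaceI prob_space_normal_shift)
  show ?thesis
    unfolding data_law_def
    by (subst product_nn_integral_prod) (auto simp: nn_integral_density)
qed

lemma mixture_eq_convex:
  assumes "\<gamma> = (1 - t) * \<beta> + t * \<alpha>"
  shows "mixture n \<gamma> x = (1 - t) * mixture n \<beta> x + t * mixture n \<alpha> x"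
  by (simp add: mixture_def assms algebra_simps)

lemma ln_convex_combination:
  fixes x y :: real
  assumes "0 < x" "0 < y" "0 \<le> t" "t \<le> 1"
  shows "(1 - t) * ln x + t * ln y \<le> ln ((1 - t) * x + t * y)"
  using concave_onD[OF ln_concave assms(3,4), of x y] assms by simp

text \<open>The log-likelihood is concave, hence increasing to the left of its maximiser. A large
  maximiser therefore forces a likelihood ratio, whose mean is small, to be at least one.\<close>

lemma mmle_likelihood_ratio:
  assumes n: "1 \<le> n" and mle: "is_mmle n Ccal ahat"
    and \<beta>: "Ccal * ln (real n) / real n \<le> \<beta>" "0 < \<beta>" and X: "2 * \<beta> < ahat X"
  shows "1 \<le> (\<Prod>i<n. mixture n (2 * \<beta>) (X i) / mixture n \<beta> (X i))"
proof -
  let ?\<alpha> = "ahat X"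
  have a1: "?\<alpha> \<le> 1" using mle by (auto simp: is_mmle_def)
  then have "\<beta> \<in> {Ccal * ln (real n) / real n..1}" using \<beta> X by auto
  with mle have max: "loglik n X \<beta> \<le> loglik n X ?\<alpha>"
    unfolding is_mmle_def by blast
  have m\<beta>: "0 < mixture n \<beta> x" and m2: "0 < mixture n (2 * \<beta>) x" and m\<alpha>: "0 < mixture n ?\<alpha> x" for x
    using \<beta> X a1 by (auto intro!: mixture_pos[OF n])
  \<comment> \<open>This \<open>t\<close> places \<open>2 * \<beta>\<close> on the segment from
    \<open>\<beta>\<close> to the maximiser; it is at most 1 exactly because the maximiser exceeds
    \<open>2 * \<beta>\<close>.\<close>
  define t where "t = \<beta> / (?\<alpha> - \<beta>)"
  have t: "0 \<le> t" "t \<le> 1" using \<beta> X by (auto simp: t_def field_simps)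
  have "t * (?\<alpha> - \<beta>) = \<beta>" using X \<beta> by (simp add: t_def)
  then have eq: "2 * \<beta> = (1 - t) * \<beta> + t * ?\<alpha>" by (simp add: algebra_simps)
  have lik: "loglik n X \<alpha> = (\<Sum>i<n. ln (mixture n \<alpha> (X i)))" for \<alpha>
    by (simp add: loglik_def mixture_def)
  have "t * loglik n X \<beta> \<le> t * loglik n X ?\<alpha>" using max t by (intro mult_left_mono)
  then have "loglik n X \<beta> \<le> (1 - t) * loglik n X \<beta> + t * loglik n X ?\<alpha>"
    by (simp add: algebra_simps)
  also have "\<dots> = (\<Sum>i<n. (1 - t) * ln (mixture n \<beta> (X i)) + t * ln (mixture n ?\<alpha> (X i)))"
    by (simp add: lik sum_distrib_left sum.distrib)
  also have "\<dots> \<le> loglik n X (2 * \<beta>)"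
    unfolding lik mixture_eq_convex[OF eq]
    by (intro sum_mono ln_convex_combination m\<beta> m\<alpha> t)
  finally have "0 \<le> loglik n X (2 * \<beta>) - loglik n X \<beta>" by simp
  also have "\<dots> = (\<Sum>i<n. ln (mixture n (2 * \<beta>) (X i) / mixture n \<beta> (X i)))"
    using m\<beta> m2 by (simp add: lik ln_div sum_subtractf less_imp_neq[symmetric])
  also have "\<dots> = ln (\<Prod>i<n. mixture n (2 * \<beta>) (X i) / mixture n \<beta> (X i))"
    using less_imp_neq[OF m\<beta>] less_imp_neq[OF m2] by (subst ln_prod) auto
  finally show ?thesis
    using m\<beta> m2 by (subst (asm) ln_ge_zero_iff) (auto intro!: prod_pos)
qed

text \<open>This deterministic bound serves signals of any size.\<close>

lemma mixture_ratio_le_2: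
  assumes n: "1 \<le> n" and \<beta>: "0 < \<beta>" "\<beta> \<le> 1"
  shows "mixture n (2 * \<beta>) x / mixture n \<beta> x \<le> 2"
proof -
  have "mixture n (2 * \<beta>) x = 2 * mixture n \<beta> x - g0 n x"
    by (simp add: mixture_def algebra_simps)
  then show ?thesis
    using mixture_pos[OF n _ \<beta>(2), of x] \<beta>(1) g0_pos[OF n, of x] by (simp add: divide_le_eq)
qed

lemma has_bochner_integral_marginal:
  "has_bochner_integral lborel g1 1"
  "1 \<le> n \<Longrightarrow> has_bochner_integral lborel (g0 n) 1"
  using nn_integral_g1 nn_integral_g0[of n]
  by (auto intro!: has_bochner_integral_nn_integral simp: less_imp_le g0_pos g1_pos)

text \<open>The loss relative to the mixture is exactly
  \<open>(\<beta> * (g1 x - g0 n x))\<^sup>2 / mixture n \<beta> x\<close>. In the window the slab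
  dominates: \<open>g0\<close> is at most \<open>\<beta> * g1 x\<close>, so the mixture is at most
  \<open>2 * \<beta> * g1 x\<close> and the difference at least \<open>g1 x / 2\<close>. The loss is
  then at least \<open>\<beta> * g1 x / 8\<close>, linear in \<open>\<beta>\<close>.\<close>

lemma mixture_ratio_spike_le:
  assumes n: "400000 \<le> n" and \<beta>: "1 / real n \<le> \<beta>" "\<beta> \<le> 1 / 2"
  shows "g0 n x * (mixture n (2 * \<beta>) x / mixture n \<beta> x)
    \<le> mixture n \<beta> x - \<beta> * (3 / (1160000 * ln (real n)) *
        indicator {6 * sqrt (ln (real n))..12 * sqrt (ln (real n))} x)"
proof -
  have n1: "1 \<le> n" using n by simp
  have \<beta>0: "0 < \<beta>" using less_le_trans[OF _ \<beta>(1)] n1 by simp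
  have L: "1 \<le> ln (real n)" by (rule ln_ge_1[OF n])
  let ?m = "mixture n \<beta> x" and ?d = "g1 x - g0 n x"
  have m: "0 < ?m" using \<beta> \<beta>0 by (intro mixture_pos[OF n1]) auto
  have m1: "?m - g0 n x = \<beta> * ?d" and m2: "mixture n (2 * \<beta>) x = ?m + \<beta> * ?d"
    by (auto simp: mixture_def algebra_simps)
  have "?m - g0 n x * (mixture n (2 * \<beta>) x / ?m) = (?m * ?m - g0 n x * (?m + \<beta> * ?d)) / ?m"
    unfolding m2 using m by (simp add: field_simps)
  also have "?m * ?m - g0 n x * (?m + \<beta> * ?d) = ?m * (?m - g0 n x) - g0 n x * (\<beta> * ?d)"
    by (simp add: algebra_simps)
  also have "\<dots> = (?m - g0 n x) * (\<beta> * ?d)"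
    unfolding m1[symmetric] by (simp add: algebra_simps)
  also have "\<dots> = (\<beta> * ?d)\<^sup>2" unfolding m1 by (simp add: power2_eq_square)
  finally have key: "?m - g0 n x * (mixture n (2 * \<beta>) x / ?m) = (\<beta> * ?d)\<^sup>2 / ?m" .
  show ?thesis
  proof (cases "x \<in> {6 * sqrt (ln (real n))..12 * sqrt (ln (real n))}")
    case False
    have "0 \<le> (\<beta> * ?d)\<^sup>2 / ?m" using m by simp
    with key False show ?thesis by simp
  next
    case True
    then have x6: "6 * sqrt (ln (real n)) \<le> \<bar>x\<bar>" by simp
    have "x\<^sup>2 \<le> (12 * sqrt (ln (real n)))\<^sup>2"
      using True L by (intro power_mono) (auto intro: order_trans[rotated])
    then have xx: "1 + x\<^sup>2 \<le> 145 * ln (real n)" using L by (simp add: power_mult_distrib)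
    have g: "0 < g0 n x" "0 < g1 x" using g0_pos[OF n1] g1_pos by auto
    have "1 * (real n * g0 n x) \<le> (1 + x\<^sup>2) * (real n * g0 n x)"
      using g by (intro mult_right_mono) auto
    with g0_tail[OF n x6] have "real n * g0 n x \<le> g1 x" by simp
    then have "g0 n x \<le> 1 / real n * g1 x" using n1 by (simp add: field_simps)
    also have "\<dots> \<le> \<beta> * g1 x" using \<beta>(1) g by (intro mult_right_mono) auto
    finally have ga: "g0 n x \<le> \<beta> * g1 x" .
    also have "\<dots> \<le> 1 / 2 * g1 x" using \<beta>(2) g by (intro mult_right_mono) auto
    finally have d: "g1 x / 2 \<le> ?d" by simp
    have mu: "?m \<le> 2 * \<beta> * g1 x"
    proof -
      have "(1 - \<beta>) * g0 n x \<le> 1 * g0 n x" using \<beta>0 g by (intro mult_right_mono) auto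
      with ga show ?thesis by (simp add: mixture_def)
    qed
    \<comment> \<open>In the window 1 + x^2 is at most (1 + 144) log n, and 1160000 = 8 * 145 *
      1000.\<close>
    have "3 / 1000 \<le> 145 * ln (real n) * g1 x"
      using g1_lower[of x] mult_right_mono[OF xx, of "g1 x"] g by linarith
    then have "3 / (1160000 * ln (real n)) \<le> g1 x / 8"
      using L by (simp add: divide_simps mult_ac)
    then have "\<beta> * (3 / (1160000 * ln (real n))) \<le> \<beta> * (g1 x / 8)"
      using \<beta>0 by (intro mult_left_mono) auto
    also have "\<dots> = (\<beta> * (g1 x / 2))\<^sup>2 / (2 * \<beta> * g1 x)"
      using \<beta>0 g by (simp add: field_simps power2_eq_square)
    also have "\<dots> \<le> (\<beta> * ?d)\<^sup>2 / ?m"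
      using \<beta>0 g d m mu by (intro frac_le power_mono mult_left_mono) auto
    finally show ?thesis using key True by simp
  qed
qed

lemma null_likelihood_ratio_mean:
  assumes n: "400000 \<le> n" and \<beta>: "1 / real n \<le> \<beta>" "\<beta> \<le> 1 / 2"
  shows "(\<integral>\<^sup>+x. ennreal (phi x) * ennreal (mixture n (2 * \<beta>) x / mixture n \<beta> x) \<partial>lborel)
    \<le> ennreal (exp (1 / real n - \<beta> / (80000 * sqrt (ln (real n)))))"
proof -
  have n1: "1 \<le> n" and rn: "0 < real n" using n by auto
  have \<beta>0: "0 < \<beta>" using less_le_trans[OF _ \<beta>(1)] n1 by simp
  have L: "1 \<le> ln (real n)" by (rule ln_ge_1[OF n])
  define q where "q = sqrt (ln (real n))"
  have q: "1 \<le> q" "ln (real n) = q\<^sup>2" using L by (auto simp: q_def)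
  let ?r = "\<lambda>x. mixture n (2 * \<beta>) x / mixture n \<beta> x"
  have r: "0 \<le> ?r x" for x
    using mixture_pos[OF n1, of "2 * \<beta>" x] mixture_pos[OF n1, of \<beta> x] \<beta> \<beta>0 by simp
  let ?c = "3 / (1160000 * q\<^sup>2)"
  \<comment> \<open>The mixture is expanded so that its integral follows from the unit masses of
    \<open>g0\<close> and \<open>g1\<close>.\<close>
  let ?h = "\<lambda>x. (1 + 1 / real n) * (((1 - \<beta>) * g0 n x + \<beta> * g1 x) - \<beta> * (?c * indicator {6 * q..12 * q} x))"
  have le: "phi x * ?r x \<le> ?h x" for x
  proof -
    have "phi x * ?r x \<le> ((1 + 1 / real n) * g0 n x) * ?r x"
      by (intro mult_right_mono phi_le_g0 n1 r)
    also have "\<dots> = (1 + 1 / real n) * (g0 n x * ?r x)" by simp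
    also have "\<dots> \<le> ?h x"
      using mixture_ratio_spike_le[OF n \<beta>, of x] unfolding q_def[symmetric] mixture_def[of n \<beta> x, symmetric]
      by (intro mult_left_mono) (auto simp: q(2)[symmetric])
    finally show ?thesis .
  qed
  have "has_bochner_integral lborel ?h ((1 + 1 / real n) * (((1 - \<beta>) * 1 + \<beta> * 1) - \<beta> * (?c * measure lborel {6 * q..12 * q})))"
    using has_bochner_integral_marginal(1) has_bochner_integral_marginal(2)[OF n1]
    by (intro has_bochner_integral_mult_right has_bochner_integral_add has_bochner_integral_diff
        has_bochner_integral_real_indicator) (auto simp: emeasure_lborel_Icc_eq)
  then have H: "has_bochner_integral lborel ?h ((1 + 1 / real n) * (1 - \<beta> * (?c * (6 * q))))"
    using q by simp
  have h0: "0 \<le> ?h x" for x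
    using le[of x] mult_nonneg_nonneg[OF less_imp_le[OF phi_pos[of x]] r[of x]] by linarith
  have "(\<integral>\<^sup>+x. ennreal (phi x) * ennreal (?r x) \<partial>lborel) \<le> (\<integral>\<^sup>+x. ennreal (?h x) \<partial>lborel)"
    using le r phi_pos by (intro nn_integral_mono) (auto simp: ennreal_mult[symmetric] less_imp_le intro!: ennreal_leI)
  also have "\<dots> = ennreal ((1 + 1 / real n) * (1 - \<beta> * (?c * (6 * q))))"
    using H h0 by (subst nn_integral_eq_integral) (auto simp: has_bochner_integral_iff)
  also have "\<dots> \<le> ennreal (exp (1 / real n - \<beta> / (80000 * q)))"
  proof (rule ennreal_leI)
    \<comment> \<open>The window has length 6 q, so the loss 3/(1160000 q^2) integrates to
      18/(1160000 q), which exceeds 1/(80000 q).\<close>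
    have "1 / (80000 * q) \<le> ?c * (6 * q)"
      using q(1) by (simp add: field_simps power2_eq_square)
    then have "\<beta> * (1 / (80000 * q)) \<le> \<beta> * (?c * (6 * q))"
      using \<beta>0 by (intro mult_left_mono) auto
    then have "1 - \<beta> * (?c * (6 * q)) \<le> 1 - \<beta> / (80000 * q)" by simp
    also have "\<dots> \<le> exp (- (\<beta> / (80000 * q)))"
      using exp_ge_add_one_self[of "- (\<beta> / (80000 * q))"] by simp
    finally have "(1 + 1 / real n) * (1 - \<beta> * (?c * (6 * q))) \<le> exp (1 / real n) * exp (- (\<beta> / (80000 * q)))"
      using exp_ge_add_one_self[of "1 / real n"] rn
      by (intro order_trans[OF mult_left_mono mult_right_mono]) auto
    then show "(1 + 1 / real n) * (1 - \<beta> * (?c * (6 * q))) \<le> exp (1 / real n - \<beta> / (80000 * q))"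
      by (simp add: exp_add[symmetric])
  qed
  finally show ?thesis by (simp add: q_def)
qed

text \<open>By independence the mean factorises over coordinates: at most s signals contribute a
  factor 2 each, and every null contributes the exponential bound of
  \<open>null_likelihood_ratio_mean\<close>.\<close>

lemma likelihood_ratio_mean:
  assumes n: "400000 \<le> n" and \<beta>: "1 / real n \<le> \<beta>" "\<beta> \<le> 1 / 2"
    and \<theta>: "\<theta> \<in> ell0 n s" and s: "real s \<le> real n / 2"
  shows "(\<integral>\<^sup>+X. ennreal (\<Prod>i<n. mixture n (2 * \<beta>) (X i) / mixture n \<beta> (X i)) \<partial>data_law n \<theta>)
    \<le> ennreal (2 ^ s * exp (1 - real n * \<beta> / (160000 * sqrt (ln (real n)))))"
proof -
  have n1: "1 \<le> n" and rn: "0 < real n" using n by auto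
  have \<beta>0: "0 < \<beta>" using less_le_trans[OF _ \<beta>(1)] n1 by simp
  have L: "1 \<le> ln (real n)" by (rule ln_ge_1[OF n])
  let ?r = "\<lambda>x. mixture n (2 * \<beta>) x / mixture n \<beta> x"
  have r: "0 \<le> ?r x" for x
    using mixture_pos[OF n1, of "2 * \<beta>" x] mixture_pos[OF n1, of \<beta> x] \<beta> \<beta>0 by simp
  let ?S = "{i\<in>{..<n}. \<theta> i \<noteq> 0}"
  define y where "y = \<beta> / (80000 * sqrt (ln (real n)))"
  have y: "0 \<le> y" using \<beta>0 L by (simp add: y_def)
  define E where "E = exp (1 / real n - y)"
  have cS: "card ?S \<le> s" using \<theta> by (simp add: ell0_def)
  have "(\<integral>\<^sup>+X. ennreal (\<Prod>i<n. ?r (X i)) \<partial>data_law n \<theta>) = (\<integral>\<^sup>+X. (\<Prod>i<n. ennreal (?r (X i))) \<partial>data_law n \<theta>)"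
    using r by (intro nn_integral_cong) (auto simp: prod_ennreal)
  also have "\<dots> = (\<Prod>i<n. \<integral>\<^sup>+x. ennreal (normal_density (\<theta> i) 1 x) * ennreal (?r x) \<partial>lborel)"
    by (rule nn_integral_data_law_prod) measurable
  also have "\<dots> \<le> (\<Prod>i<n. ennreal (if \<theta> i \<noteq> 0 then 2 else E))"
  proof (rule prod_mono_ennreal)
    fix i assume "i \<in> {..<n}"
    show "(\<integral>\<^sup>+x. ennreal (normal_density (\<theta> i) 1 x) * ennreal (?r x) \<partial>lborel)
        \<le> ennreal (if \<theta> i \<noteq> 0 then 2 else E)"
    proof (cases "\<theta> i = 0")
      case True
      then show ?thesis
        using null_likelihood_ratio_mean[OF n \<beta>] by (simp add: E_def y_def phi_def)
    next
      case False
      have "(\<integral>\<^sup>+x. ennreal (normal_density (\<theta> i) 1 x) * ennreal (?r x) \<partial>lborel)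
          \<le> (\<integral>\<^sup>+x. ennreal (normal_density (\<theta> i) 1 x) * ennreal 2 \<partial>lborel)"
        using mixture_ratio_le_2[OF n1 \<beta>0] \<beta> by (intro nn_integral_mono mult_left_mono ennreal_leI) auto
      also have "\<dots> = ennreal 2"
        by (subst nn_integral_multc) (auto simp: nn_integral_eq_integral)
      finally show ?thesis using False by simp
    qed
  qed
  also have "\<dots> = ennreal (\<Prod>i<n. if \<theta> i \<noteq> 0 then 2 else E)"
    by (subst prod_ennreal) (auto simp: E_def)
  also have "(\<Prod>i<n. if \<theta> i \<noteq> 0 then 2 else E) = 2 ^ card ?S * E ^ card ({..<n} - ?S)"
  proof -
    have "{..<n} \<inter> - {i. \<theta> i \<noteq> 0} = {..<n} - ?S" "{..<n} \<inter> {i. \<theta> i \<noteq> 0} = ?S" by auto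
    then show ?thesis by (simp add: prod.If_cases)
  qed
  also have "card ({..<n} - ?S) = n - card ?S"
    by (subst card_Diff_subset) auto
  also have "ennreal (2 ^ card ?S * E ^ (n - card ?S)) \<le> ennreal (2 ^ s * exp (1 - real n / 2 * y))"
  proof (intro ennreal_leI mult_mono)
    show "(2::real) ^ card ?S \<le> 2 ^ s" using cS by (intro power_increasing) auto
    define k where "k = n - card ?S"
    \<comment> \<open>At least half of the coordinates are null, which halves the rate 1/80000 to
      1/160000; the excesses 1/n of at most n nulls add up to at most 1.\<close>
    have k: "real n / 2 \<le> real k" "real k \<le> real n"
      using cS s by (auto simp: k_def of_nat_diff card_mono)
    have "E ^ k = exp (real k * (1 / real n - y))" by (simp add: E_def exp_of_nat_mult)
    also have "\<dots> \<le> exp (1 - real n / 2 * y)"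
    proof -
      have "real k * (1 / real n) \<le> 1" using k rn by (simp add: field_simps)
      moreover have "real n / 2 * y \<le> real k * y" using k y by (intro mult_right_mono) auto
      ultimately show ?thesis by (simp add: right_diff_distrib)
    qed
    finally show "E ^ (n - card ?S) \<le> exp (1 - real n / 2 * y)" by (simp add: k_def)
  qed (auto simp: E_def)
  also have "real n / 2 * y = real n * \<beta> / (160000 * sqrt (ln (real n)))" by (simp add: y_def)
  finally show ?thesis .
qed

subsection \<open>Risk bounds\<close>

lemma has_bochner_integral_phi:
  "has_bochner_integral lborel phi 1"
  "has_bochner_integral lborel (\<lambda>x. phi x * x\<^sup>2) 1"
  "has_bochner_integral lborel (\<lambda>x. phi x * x ^ 4) 3"
  using std_normal_moment_even[of 0] std_normal_moment_even[of 1] std_normal_moment_even[of 2]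
  by (simp_all add: phi_def[abs_def] fact_numeral)

lemma nn_integral_phi_le:
  assumes "has_bochner_integral lborel h B" "\<And>x. phi x * f x \<le> h x" "\<And>x. 0 \<le> f x"
  shows "(\<integral>\<^sup>+x. ennreal (phi x) * ennreal (f x) \<partial>lborel) \<le> ennreal B"
proof -
  have h: "0 \<le> h x" for x
    using assms(2)[of x] mult_nonneg_nonneg[OF less_imp_le[OF phi_pos[of x]] assms(3)[of x]] by linarith
  have "(\<integral>\<^sup>+x. ennreal (phi x) * ennreal (f x) \<partial>lborel) \<le> (\<integral>\<^sup>+x. ennreal (h x) \<partial>lborel)"
    using assms(2,3) phi_pos
    by (intro nn_integral_mono) (auto simp: ennreal_mult[symmetric] less_imp_le intro!: ennreal_leI)
  also have "\<dots> = ennreal B"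
    using assms(1) h by (subst nn_integral_eq_integral) (auto simp: has_bochner_integral_iff)
  finally show ?thesis .
qed

text \<open>The exponent -x^2/2 is shared out: x^2/4 yields 1/n beyond the threshold, x^2/8 absorbs
  1 + x^2 up to a factor 8, and the last x^2/8 remains as an integrable normal density of standard
  deviation 2, whose normalisation doubles 8 to 16.\<close>

lemma phi_tail_le:
  assumes n: "400000 \<le> n" and x: "2 * sqrt (ln (real n)) \<le> \<bar>x\<bar>"
  shows "phi x * (1 + x\<^sup>2) \<le> 16 / real n * normal_density 0 2 x"
proof -
  have "exp (- (1/4 * x\<^sup>2)) \<le> exp (- (1/4 * 2\<^sup>2 * ln (real n)))"
    by (rule exp_minus_square_le[OF n x]) auto
  also have "\<dots> = 1 / real n" using n by (simp add: exp_minus inverse_eq_divide)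
  finally have 1: "exp (- (1/4 * x\<^sup>2)) \<le> 1 / real n" .
  have 2: "1 + x\<^sup>2 \<le> 8 * exp (x\<^sup>2 / 8)"
    using exp_ge_add_one_self[of "x\<^sup>2 / 8"] by linarith
  have "exp (- (x\<^sup>2 / 2)) * (1 + x\<^sup>2) \<le> exp (- (x\<^sup>2 / 2)) * (8 * exp (x\<^sup>2 / 8))"
    by (intro mult_left_mono 2) auto
  also have "\<dots> = 8 * exp (- (x\<^sup>2 / 8)) * exp (- (1/4 * x\<^sup>2))"
    by (simp add: exp_add[symmetric])
  also have "\<dots> \<le> 8 * exp (- (x\<^sup>2 / 8)) * (1 / real n)"
    by (intro mult_left_mono 1) auto
  finally have "1 / sqrt (2 * pi) * (exp (- (x\<^sup>2 / 2)) * (1 + x\<^sup>2))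
      \<le> 1 / sqrt (2 * pi) * (8 * exp (- (x\<^sup>2 / 8)) * (1 / real n))"
    by (intro mult_left_mono) auto
  moreover have "sqrt (2 * pi * 2\<^sup>2) = 2 * sqrt (2 * pi)"
    by (simp only: real_sqrt_mult real_sqrt_abs)
  ultimately show ?thesis
    by (simp add: phi_def std_normal_density_def normal_density_def mult_ac)
qed

lemma nn_integral_add_cmult:
  assumes "f \<in> borel_measurable M" "g \<in> borel_measurable M"
  shows "(\<integral>\<^sup>+x. f x + c * g x \<partial>M) = (\<integral>\<^sup>+x. f x \<partial>M) + c * (\<integral>\<^sup>+x. g x \<partial>M)"
  using assms by (simp add: nn_integral_add nn_integral_cmult)

text \<open>The weight \<open>ahat X\<close> depends on all coordinates, so it is removed pointwise
  before integrating: either it is at most \<open>2 * \<beta>\<close>, or the likelihood ratio is at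
  least 1. The assumption \<open>W\<close> is restricted to \<open>\<beta>\<close> at most 1/4, so
  that \<open>2 * \<beta>\<close> is still a valid weight.\<close>

lemma null_coordinate_risk:
  assumes n: "400000 \<le> n" and mle: "is_mmle n Ccal ahat"
    and \<beta>: "Ccal * ln (real n) / real n \<le> \<beta>" "1 / real n \<le> \<beta>" and Ccal: "0 \<le> Ccal"
    and i: "i < n" "\<theta> i = 0"
    and W: "\<beta> \<le> 1/4 \<Longrightarrow> (\<integral>\<^sup>+X. ennreal (\<Prod>i<n. mixture n (2 * \<beta>) (X i) / mixture n \<beta> (X i)) \<partial>data_law n \<theta>)
      \<le> ennreal (3 / (real n)\<^sup>2)"
  shows "(\<integral>\<^sup>+X. (\<integral>\<^sup>+u. ennreal ((u - \<theta> i)\<^sup>2 * post_dens n (ahat X) (X i) u) \<partial>lborel) \<partial>data_law n \<theta>)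
    \<le> ennreal (57344 * \<beta> * sqrt (ln (real n)) + 1984 / real n)"
proof -
  have n1: "1 \<le> n" and rn: "0 < real n" using n by auto
  have \<beta>0: "0 < \<beta>" using less_le_trans[OF _ \<beta>(2)] n1 by simp
  have L: "1 \<le> ln (real n)" by (rule ln_ge_1[OF n])
  define q where "q = sqrt (ln (real n))"
  have q: "1 \<le> q" using L by (simp add: q_def)
  have a: "0 \<le> ahat X" "ahat X \<le> 1" for X
  proof -
    have "Ccal * ln (real n) / real n \<le> ahat X" "ahat X \<le> 1" using mle by (auto simp: is_mmle_def)
    moreover have "0 \<le> Ccal * ln (real n) / real n" using Ccal L by simp
    ultimately show "0 \<le> ahat X" "ahat X \<le> 1" by auto
  qed
  let ?I = "\<lambda>X. \<integral>\<^sup>+u. ennreal ((u - \<theta> i)\<^sup>2 * post_dens n (ahat X) (X i) u) \<partial>lborel"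
  have I: "?I X \<le> ennreal (96 * (1 + (X i) ^ 4) / real n + 64 * ((1 + (X i)\<^sup>2) * post_a n (ahat X) (X i)))" for X
    using null_coordinate_le[OF n1 a, of X "X i"] i by simp
  show ?thesis
  proof (cases "\<beta> \<le> 1/4")
    \<comment> \<open>Here \<open>\<beta>\<close> sqrt(log n) exceeds 1/4, so bounding the posterior
      slab weight by 1 is enough.\<close>
    case False
    let ?f = "\<lambda>x. 96 * (1 + x ^ 4) / real n + 64 * (1 + x\<^sup>2)"
    have "(\<integral>\<^sup>+X. ?I X \<partial>data_law n \<theta>) \<le> (\<integral>\<^sup>+X. ennreal (?f (X i)) \<partial>data_law n \<theta>)"
    proof (rule nn_integral_mono)
      fix X
      have "(1 + (X i)\<^sup>2) * post_a n (ahat X) (X i) \<le> (1 + (X i)\<^sup>2) * 1"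
        by (intro mult_left_mono post_a_bounds[OF n1 a]) auto
      then show "?I X \<le> ennreal (?f (X i))"
        by (intro order_trans[OF I] ennreal_leI) auto
    qed
    also have "\<dots> = (\<integral>\<^sup>+x. ennreal (phi x) * ennreal (?f x) \<partial>lborel)"
      by (subst nn_integral_data_law_component[OF i(1), of "\<lambda>x. ennreal (?f x)"]) (auto simp: phi_def i)
    also have "\<dots> \<le> ennreal (96 / real n * (1 + 3) + 64 * (1 + 1))"
    proof (rule nn_integral_phi_le)
      show "has_bochner_integral lborel (\<lambda>x. 96 / real n * (phi x + phi x * x ^ 4) + 64 * (phi x + phi x * x\<^sup>2))
          (96 / real n * (1 + 3) + 64 * (1 + 1))"
        by (intro has_bochner_integral_add has_bochner_integral_mult_right has_bochner_integral_phi)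
    qed (auto simp: algebra_simps add_divide_distrib)
    also have "\<dots> \<le> ennreal (57344 * \<beta> * q + 1984 / real n)"
    proof (rule ennreal_leI)
      have "1/4 * 1 \<le> \<beta> * q" using False q by (intro mult_mono) auto
      moreover have "384 / real n \<le> 1984 / real n" by (intro divide_right_mono) auto
      ultimately show "96 / real n * (1 + 3) + 64 * (1 + 1) \<le> 57344 * \<beta> * q + 1984 / real n" by simp
    qed
    finally show ?thesis by (simp add: q_def)
  next
    case True
    let ?r = "\<lambda>x. mixture n (2 * \<beta>) x / mixture n \<beta> x"
    let ?W = "\<lambda>X. \<Prod>i<n. ?r (X i)"
    have r: "0 \<le> ?r x" for x
      using mixture_pos[OF n1, of "2 * \<beta>" x] mixture_pos[OF n1, of \<beta> x] True \<beta>0 by simp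
    have W0: "0 \<le> ?W X" for X by (intro prod_nonneg r)
    \<comment> \<open>Inside the window this is \<open>post_a_le\<close> at
      \<open>2 * \<beta>\<close>; outside, the weight is bounded by 1 and \<open>phi_tail_le\<close>
      makes the contribution of order 1/n.\<close>
    let ?b = "\<lambda>x. if \<bar>x\<bar> \<le> 2 * q then 224 * \<beta> / phi x else 1 + x\<^sup>2"
    have b0: "0 \<le> ?b x" for x using \<beta>0 phi_pos[of x] by auto
    let ?f = "\<lambda>x. 96 * (1 + x ^ 4) / real n + 64 * ?b x + 64 * (1 + x\<^sup>2)\<^sup>2 / real n"
    have f0: "0 \<le> ?f x" for x using b0[of x] by simp
    have [measurable]: "?f \<in> borel_measurable borel" by measurable
    have "?I X \<le> ennreal (?f (X i)) + ennreal (64 * real n) * ennreal (?W X)" for X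
    proof -
      let ?x = "X i"
      \<comment> \<open>This is Markov's inequality in pointwise form: no indicator of the event
        that the weight is large appears, only the likelihood ratio itself.\<close>
      have *: "(1 + ?x\<^sup>2) * post_a n (ahat X) ?x \<le> ?b ?x + real n * ?W X + (1 + ?x\<^sup>2)\<^sup>2 / real n"
      proof (cases "ahat X \<le> 2 * \<beta>")
        case le: True
        have "(1 + ?x\<^sup>2) * post_a n (ahat X) ?x \<le> ?b ?x"
        proof (cases "\<bar>?x\<bar> \<le> 2 * q")
          case True
          then show ?thesis
            using post_a_le[OF n1 a(1)[of X] le, of ?x] \<open>\<beta> \<le> 1/4\<close> by simp
        next
          case False
          then show ?thesis
            using mult_left_mono[OF post_a_bounds(2)[OF n1 a, of X ?x], of "1 + ?x\<^sup>2"] by simp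
        qed
        moreover have "0 \<le> real n * ?W X" "0 \<le> (1 + ?x\<^sup>2)\<^sup>2 / real n" using W0[of X] by auto
        ultimately show ?thesis by linarith
      next
        case False
        then have W1: "1 \<le> ?W X"
          using mmle_likelihood_ratio[OF n1 mle \<beta>(1) \<beta>0] by simp
        have "(1 + ?x\<^sup>2) * post_a n (ahat X) ?x \<le> 1 + ?x\<^sup>2"
          using mult_left_mono[OF post_a_bounds(2)[OF n1 a, of X ?x], of "1 + ?x\<^sup>2"] by simp
        \<comment> \<open>By y <= n + y^2/n, the unbounded factor 1 + x^2 separates from the
          likelihood ratio, with which it is dependent. The price n is paid by the mean of order
          n^(-2).\<close>
        also have "\<dots> \<le> real n + (1 + ?x\<^sup>2)\<^sup>2 / real n"
        proof -
          have "y * real n \<le> real n * real n + y\<^sup>2" if "0 \<le> y" for y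
            using zero_le_power2[of "real n - y"] mult_nonneg_nonneg[OF that, of "real n"] rn
            by (simp add: power2_eq_square algebra_simps)
          from this[of "1 + ?x\<^sup>2"] rn show ?thesis
            by (simp add: field_simps)
        qed
        finally have "(1 + ?x\<^sup>2) * post_a n (ahat X) ?x \<le> real n + (1 + ?x\<^sup>2)\<^sup>2 / real n" .
        moreover have "real n * 1 \<le> real n * ?W X" by (intro mult_left_mono W1) auto
        ultimately show ?thesis using b0[of ?x] by linarith
      qed
      have "?I X \<le> ennreal (?f ?x + 64 * real n * ?W X)"
        using * by (intro order_trans[OF I] ennreal_leI) (simp add: algebra_simps)
      also have "\<dots> = ennreal (?f ?x) + ennreal (64 * real n) * ennreal (?W X)"
        using f0[of ?x] W0[of X] by (simp add: ennreal_plus ennreal_mult'[symmetric])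
      finally show ?thesis .
    qed
    then have "(\<integral>\<^sup>+X. ?I X \<partial>data_law n \<theta>)
        \<le> (\<integral>\<^sup>+X. ennreal (?f (X i)) + ennreal (64 * real n) * ennreal (?W X) \<partial>data_law n \<theta>)"
      by (intro nn_integral_mono)
    also have "\<dots> = (\<integral>\<^sup>+X. ennreal (?f (X i)) \<partial>data_law n \<theta>)
        + ennreal (64 * real n) * (\<integral>\<^sup>+X. ennreal (?W X) \<partial>data_law n \<theta>)"
    proof (rule nn_integral_add_cmult)
      have [measurable]: "(\<lambda>X. X j) \<in> borel_measurable (data_law n \<theta>)" if "j < n" for j
        unfolding data_law_def using that by (auto intro!: measurable_component_singleton)
      show "(\<lambda>X. ennreal (?f (X i))) \<in> borel_measurable (data_law n \<theta>)"
        using i by measurable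
      show "(\<lambda>X. ennreal (?W X)) \<in> borel_measurable (data_law n \<theta>)"
        by measurable
    qed
    also have "(\<integral>\<^sup>+X. ennreal (?f (X i)) \<partial>data_law n \<theta>) = (\<integral>\<^sup>+x. ennreal (phi x) * ennreal (?f x) \<partial>lborel)"
      by (subst nn_integral_data_law_component[OF i(1), of "\<lambda>x. ennreal (?f x)"]) (auto simp: phi_def i)
    also have "\<dots> \<le> ennreal (96 / real n * (1 + 3) + 64 * (224 * \<beta> * (4 * q) + 16 / real n * 1)
        + 64 / real n * (1 + 2 * 1 + 3))"
    proof (rule nn_integral_phi_le)
      let ?k = "\<lambda>x. 224 * \<beta> * indicator {-2 * q..2 * q} x + 16 / real n * normal_density 0 2 x"
      have "has_bochner_integral lborel (indicator {-2 * q..2 * q}) (measure lborel {-2 * q..2 * q})"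
        by (rule has_bochner_integral_real_indicator) (auto simp: emeasure_lborel_Icc_eq)
      then have ind: "has_bochner_integral lborel (indicator {-2 * q..2 * q}) (4 * q)"
        using q by simp
      have nd: "has_bochner_integral lborel (normal_density 0 2) 1"
        by (simp add: has_bochner_integral_iff)
      show "has_bochner_integral lborel
          (\<lambda>x. 96 / real n * (phi x + phi x * x ^ 4) + 64 * ?k x
            + 64 / real n * (phi x + 2 * (phi x * x\<^sup>2) + phi x * x ^ 4))
          (96 / real n * (1 + 3) + 64 * (224 * \<beta> * (4 * q) + 16 / real n * 1) + 64 / real n * (1 + 2 * 1 + 3))"
        by (intro has_bochner_integral_add has_bochner_integral_mult_right has_bochner_integral_phi ind nd)
      fix x
      have "phi x * ?b x \<le> ?k x"
      proof (cases "\<bar>x\<bar> \<le> 2 * q")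
        case True
        then have "x \<in> {-2 * q..2 * q}" by auto
        then show ?thesis using True phi_pos[of x] by simp
      next
        case False
        then have "phi x * (1 + x\<^sup>2) \<le> 16 / real n * normal_density 0 2 x"
          by (intro phi_tail_le[OF n]) (simp add: q_def)
        then show ?thesis using False \<beta>0 by (simp add: add_increasing)
      qed
      moreover have "phi x * ?f x = 96 / real n * (phi x + phi x * x ^ 4) + 64 * (phi x * ?b x)
            + 64 / real n * (phi x + 2 * (phi x * x\<^sup>2) + phi x * x ^ 4)"
      proof -
        have "(1 + x\<^sup>2)\<^sup>2 = 1 + 2 * x\<^sup>2 + x ^ 4" by (simp add: power2_sum)
        moreover have "p * (96 * (1 + y) / N + 64 * b + 64 * (1 + 2 * z + y) / N)
            = 96 / N * (p + p * y) + 64 * (p * b) + 64 / N * (p + 2 * (p * z) + p * y)" for p y z b N :: real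
          by (simp add: algebra_simps add_divide_distrib)
        ultimately show ?thesis by simp
      qed
      ultimately show "phi x * ?f x \<le> 96 / real n * (phi x + phi x * x ^ 4) + 64 * ?k x
            + 64 / real n * (phi x + 2 * (phi x * x\<^sup>2) + phi x * x ^ 4)"
        by simp
    qed (rule f0)
    also have "ennreal (64 * real n) * (\<integral>\<^sup>+X. ennreal (?W X) \<partial>data_law n \<theta>)
        \<le> ennreal (64 * real n) * ennreal (3 / (real n)\<^sup>2)"
      using W[OF True] by (intro mult_left_mono) auto
    also have "ennreal (96 / real n * (1 + 3) + 64 * (224 * \<beta> * (4 * q) + 16 / real n * 1)
          + 64 / real n * (1 + 2 * 1 + 3)) + ennreal (64 * real n) * ennreal (3 / (real n)\<^sup>2)
        = ennreal (57344 * \<beta> * q + 1984 / real n)"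
    proof -
      \<comment> \<open>The constants are 64 * 224 * 4 = 57344 and 384 + 1024 + 384 + 192 =
        1984.\<close>
      have "64 * real n * (3 / (real n)\<^sup>2) = 192 / real n" using rn by (simp add: power2_eq_square)
      then have "ennreal (64 * real n) * ennreal (3 / (real n)\<^sup>2) = ennreal (192 / real n)"
        by (subst ennreal_mult[symmetric]) auto
      then show ?thesis
        using \<beta>0 q rn by (simp add: ennreal_plus[symmetric] algebra_simps del: ennreal_plus)
    qed
    finally show ?thesis by (simp add: q_def add_right_mono)
  qed
qed

text \<open>The bound of \<open>signal_coordinate_le\<close> is uniform over weights of at least
  1/n, so the dependence of \<open>ahat\<close> on the data causes no difficulty.\<close>

lemma signal_coordinate_risk:
  assumes n: "400000 \<le> n" and a: "\<And>X. 1 / real n \<le> ahat X" "\<And>X. ahat X \<le> 1" and i: "i < n"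
  shows "(\<integral>\<^sup>+X. (\<integral>\<^sup>+u. ennreal ((u - \<theta> i)\<^sup>2 * post_dens n (ahat X) (X i) u) \<partial>lborel) \<partial>data_law n \<theta>)
    \<le> ennreal (2582 * ln (real n))"
proof -
  have L: "1 \<le> ln (real n)" by (rule ln_ge_1[OF n])
  let ?f = "\<lambda>x. 2 * (x - \<theta> i)\<^sup>2 + 2580 * ln (real n)"
  have "(\<integral>\<^sup>+X. (\<integral>\<^sup>+u. ennreal ((u - \<theta> i)\<^sup>2 * post_dens n (ahat X) (X i) u) \<partial>lborel) \<partial>data_law n \<theta>)
      \<le> (\<integral>\<^sup>+X. ennreal (?f (X i)) \<partial>data_law n \<theta>)"
    by (intro nn_integral_mono signal_coordinate_le[OF n a])
  also have "\<dots> = (\<integral>\<^sup>+x. ennreal (normal_density (\<theta> i) 1 x) * ennreal (?f x) \<partial>lborel)"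
    by (rule nn_integral_data_law_component[OF i]) measurable
  also have "\<dots> = (\<integral>\<^sup>+x. ennreal (2 * (normal_density (\<theta> i) 1 x * (x - \<theta> i)\<^sup>2)
      + 2580 * ln (real n) * normal_density (\<theta> i) 1 x) \<partial>lborel)"
    using L by (intro nn_integral_cong) (auto simp: ennreal_mult[symmetric] algebra_simps intro!: arg_cong[where f=ennreal])
  also have "\<dots> = ennreal (2 * 1 + 2580 * ln (real n) * 1)"
  proof -
    have "has_bochner_integral lborel (\<lambda>x. normal_density (\<theta> i) 1 x * (x - \<theta> i)\<^sup>2) 1"
      using normal_moment_even[of 1 "\<theta> i" 1] by (simp add: fact_numeral)
    moreover have "has_bochner_integral lborel (normal_density (\<theta> i) 1) 1"
      by (simp add: has_bochner_integral_iff)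
    ultimately have "has_bochner_integral lborel (\<lambda>x. 2 * (normal_density (\<theta> i) 1 x * (x - \<theta> i)\<^sup>2)
        + 2580 * ln (real n) * normal_density (\<theta> i) 1 x) (2 * 1 + 2580 * ln (real n) * 1)"
      by (intro has_bochner_integral_add has_bochner_integral_mult_right)
    then show ?thesis
      using L by (subst nn_integral_eq_integral) (auto simp: has_bochner_integral_iff)
  qed
  also have "\<dots> \<le> ennreal (2582 * ln (real n))"
    using L by (intro ennreal_leI) simp
  finally show ?thesis .
qed

text \<open>Measurability of \<open>ahat\<close> enters here: the outer integral is exchanged with
  the sum, and every summand depends on the data through \<open>ahat X\<close> as well.\<close>

lemma post_risk_eq_sum:
  assumes n: "1 \<le> n" and a: "\<And>X. 0 \<le> ahat X" "\<And>X. ahat X \<le> 1"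
    and meas: "ahat \<in> borel_measurable (PiM {..<n} (\<lambda>_. lborel))"
  shows "post_risk n ahat \<theta> = (\<Sum>i<n. \<integral>\<^sup>+X. (\<integral>\<^sup>+u. ennreal ((u - \<theta> i)\<^sup>2 * post_dens n (ahat X) (X i) u) \<partial>lborel) \<partial>data_law n \<theta>)"
proof -
  have sets: "sets (data_law n \<theta>) = sets (PiM {..<n} (\<lambda>_. lborel))"
    unfolding data_law_def by (intro sets_PiM_cong) auto
  have [measurable]: "ahat \<in> borel_measurable (data_law n \<theta>)"
    using meas by (simp cong: measurable_cong_sets add: measurable_cong_sets[OF sets refl])
  have "(\<lambda>X. \<integral>\<^sup>+u. ennreal ((u - \<theta> i)\<^sup>2 * post_dens n (ahat X) (X i) u) \<partial>lborel) \<in> borel_measurable (data_law n \<theta>)"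
    if "i \<in> {..<n}" for i
  proof -
    have [measurable]: "(\<lambda>X. X i) \<in> borel_measurable (data_law n \<theta>)"
      unfolding data_law_def using that by (auto intro!: measurable_component_singleton)
    show ?thesis
      unfolding post_dens_def post_a_def by measurable
  qed
  then show ?thesis
    unfolding post_risk_def nn_integral_posterior[OF n a] by (intro nn_integral_sum)
qed

lemma post_risk_le:
  assumes n: "400000 \<le> n" and Ccal: "1 \<le> Ccal" and mle: "is_mmle n Ccal ahat"
    and \<theta>: "\<theta> \<in> ell0 n s" and s: "real s \<le> 1/2 * real n"
  shows "post_risk n ahat \<theta> \<le>
    ennreal ((57344 * (320000 + Ccal) + 4566) * (real s * ln (real n) + ln (real n) ^ 3))"
proof -
  have n1: "1 \<le> n" and rn: "0 < real n" using n by auto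
  have L: "1 \<le> ln (real n)" by (rule ln_ge_1[OF n])
  define q where "q = sqrt (ln (real n))"
  have q: "1 \<le> q" and qq: "ln (real n) = q\<^sup>2" using L by (auto simp: q_def)
  have qp: "q\<^sup>2 \<le> q ^ 3" "q\<^sup>2 \<le> q ^ 4" "q ^ 5 \<le> q ^ 6" "1 \<le> q ^ 4" "1 \<le> q ^ 6"
    using q by (auto intro!: power_increasing)
  define K where "K = 320000 + Ccal"
  \<comment> \<open>With q = sqrt(log n), the term s q makes the null factors beat 2^s, and q^4 =
    log^2 n supplies the additional n^(-2). The part \<open>Ccal\<close> of K keeps
    \<open>\<beta>\<close> above the left end of the range of weights.\<close>
  define \<beta> where "\<beta> = K * (real s * q + q ^ 4) / real n"
  have nb: "real n * \<beta> = K * (real s * q + q ^ 4)" using rn by (simp add: \<beta>_def)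
  have K: "320000 \<le> K" "Ccal \<le> K" using Ccal by (auto simp: K_def)
  have "Ccal * q\<^sup>2 \<le> K * (real s * q + q ^ 4)"
    using K Ccal q qp by (intro mult_mono) (auto intro: add_increasing)
  then have \<beta>1: "Ccal * ln (real n) / real n \<le> \<beta>"
    unfolding \<beta>_def qq by (intro divide_right_mono) auto
  have "1 * 1 \<le> Ccal * ln (real n)" using Ccal L by (intro mult_mono) auto
  then have min: "1 / real n \<le> Ccal * ln (real n) / real n"
    using rn by (intro divide_right_mono) auto
  with \<beta>1 have \<beta>2: "1 / real n \<le> \<beta>" by linarith
  have a: "1 / real n \<le> ahat X" "ahat X \<le> 1" for X
  proof -
    have "Ccal * ln (real n) / real n \<le> ahat X" "ahat X \<le> 1" using mle by (auto simp: is_mmle_def)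
    with min show "1 / real n \<le> ahat X" "ahat X \<le> 1" by auto
  qed
  have a0: "0 \<le> ahat X" for X using order_trans[OF _ a(1)[of X]] by simp
  have meas: "ahat \<in> borel_measurable (PiM {..<n} (\<lambda>_. lborel))" using mle by (simp add: is_mmle_def)
  have W: "(\<integral>\<^sup>+X. ennreal (\<Prod>i<n. mixture n (2 * \<beta>) (X i) / mixture n \<beta> (X i)) \<partial>data_law n \<theta>)
      \<le> ennreal (3 / (real n)\<^sup>2)" if "\<beta> \<le> 1/4"
  proof -
    have "(\<integral>\<^sup>+X. ennreal (\<Prod>i<n. mixture n (2 * \<beta>) (X i) / mixture n \<beta> (X i)) \<partial>data_law n \<theta>)
        \<le> ennreal (2 ^ s * exp (1 - real n * \<beta> / (160000 * sqrt (ln (real n)))))"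
      using that s by (intro likelihood_ratio_mean[OF n \<beta>2 _ \<theta>]) auto
    also have "\<dots> \<le> ennreal (3 / (real n)\<^sup>2)"
    proof (rule ennreal_leI)
      \<comment> \<open>Since K is at least 2 * 160000, the exponent gains at least 2 s + 2 q^3. One
        s cancels 2^s, as 2 < e, and q^3 is at least log n.\<close>
      have "2 * (real s + q ^ 3) \<le> K / 160000 * (real s + q ^ 3)"
        using K q by (intro mult_right_mono) auto
      also have "\<dots> = real n * \<beta> / (160000 * q)"
        unfolding nb using q by (simp add: field_simps eval_nat_numeral)
      finally have "1 - real n * \<beta> / (160000 * q) \<le> 1 - real s - 2 * ln (real n)"
        using qp(1) of_nat_0_le_iff[of s, where 'a = real] unfolding qq by argo
      then have "2 ^ s * exp (1 - real n * \<beta> / (160000 * q)) \<le> exp 1 ^ s * exp (1 - real s - 2 * ln (real n))"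
        using exp_ge_add_one_self[of 1] by (intro mult_mono power_mono) auto
      also have "\<dots> = exp 1 * exp (- (2 * ln (real n)))"
        by (simp add: exp_of_nat_mult[symmetric] exp_add[symmetric])
      also have "\<dots> = exp 1 / (real n)\<^sup>2"
        using rn by (simp add: exp_minus exp_double divide_inverse)
      also have "\<dots> \<le> 3 / (real n)\<^sup>2" using exp_le by (intro divide_right_mono) auto
      finally show "2 ^ s * exp (1 - real n * \<beta> / (160000 * sqrt (ln (real n)))) \<le> 3 / (real n)\<^sup>2"
        by (simp add: q_def)
    qed
    finally show ?thesis .
  qed
  let ?D = "57344 * \<beta> * q + 1984 / real n"
  have \<beta>0: "0 \<le> \<beta>" using order_trans[OF _ \<beta>2] by simp
  have D0: "0 \<le> ?D" using q \<beta>0 by simp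
  let ?S = "{i\<in>{..<n}. \<theta> i \<noteq> 0}"
  have cS: "card ?S \<le> s" using \<theta> by (simp add: ell0_def)
  have "post_risk n ahat \<theta> = (\<Sum>i<n. \<integral>\<^sup>+X. (\<integral>\<^sup>+u. ennreal ((u - \<theta> i)\<^sup>2 * post_dens n (ahat X) (X i) u) \<partial>lborel) \<partial>data_law n \<theta>)"
    by (rule post_risk_eq_sum[OF n1 a0 a(2) meas])
  also have "\<dots> \<le> (\<Sum>i<n. ennreal ((if \<theta> i \<noteq> 0 then 2582 * ln (real n) else 0) + ?D))"
  proof (rule sum_mono)
    fix i assume "i \<in> {..<n}"
    then have i: "i < n" by simp
    show "(\<integral>\<^sup>+X. (\<integral>\<^sup>+u. ennreal ((u - \<theta> i)\<^sup>2 * post_dens n (ahat X) (X i) u) \<partial>lborel) \<partial>data_law n \<theta>)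
        \<le> ennreal ((if \<theta> i \<noteq> 0 then 2582 * ln (real n) else 0) + ?D)"
    proof (cases "\<theta> i = 0")
      case True
      then show ?thesis
        using null_coordinate_risk[OF n mle \<beta>1 \<beta>2 _ i _ W] Ccal by (simp add: q_def)
    next
      case False
      then show ?thesis
        using order_trans[OF signal_coordinate_risk[OF n a i, of \<theta>] ennreal_leI] D0 by simp
    qed
  qed
  also have "\<dots> = ennreal (\<Sum>i<n. (if \<theta> i \<noteq> 0 then 2582 * ln (real n) else 0) + ?D)"
    using L D0 by (intro sum_ennreal) auto
  also have "(\<Sum>i<n. (if \<theta> i \<noteq> 0 then 2582 * ln (real n) else 0) + ?D)
      = real (card ?S) * (2582 * ln (real n)) + real n * ?D"
    by (simp add: sum.distrib sum.If_cases Int_def)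
  also have "ennreal \<dots> \<le> ennreal ((57344 * K + 4566) * (real s * ln (real n) + ln (real n) ^ 3))"
  proof (rule ennreal_leI)
    have 1: "real (card ?S) * (2582 * ln (real n)) \<le> real s * (2582 * ln (real n))"
      using cS L by (intro mult_right_mono) auto
    have "real n * ?D = 57344 * (real n * \<beta>) * q + 1984"
      using rn by (simp add: distrib_left)
    \<comment> \<open>The order obtained is s log n + log^(5/2) n; the second term is then rounded
      up to log^3 n.\<close>
    also have "\<dots> = 57344 * K * (real s * q\<^sup>2 + q ^ 5) + 1984"
      unfolding nb by (simp add: algebra_simps eval_nat_numeral)
    also have "\<dots> \<le> 57344 * K * (real s * q\<^sup>2 + q ^ 6) + 1984 * (real s * q\<^sup>2 + q ^ 6)"
    proof (intro add_mono mult_left_mono)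
      have "1 \<le> real s * q\<^sup>2 + q ^ 6" using qp by (intro add_increasing) auto
      then show "1984 \<le> 1984 * (real s * q\<^sup>2 + q ^ 6)" by simp
    qed (use qp K in auto)
    finally have 2: "real n * ?D \<le> (57344 * K + 1984) * (real s * q\<^sup>2 + q ^ 6)"
      by (simp add: distrib_right)
    have 3: "real s * (2582 * ln (real n)) \<le> 2582 * (real s * q\<^sup>2 + q ^ 6)"
      unfolding qq using q by simp
    have 4: "ln (real n) ^ 3 = q ^ 6" unfolding qq by (simp flip: power_mult)
    have "real (card ?S) * (2582 * ln (real n)) + real n * ?D
        \<le> 2582 * (real s * q\<^sup>2 + q ^ 6) + (57344 * K + 1984) * (real s * q\<^sup>2 + q ^ 6)"
      using 1 2 3 by linarith
    also have "\<dots> = (57344 * K + 4566) * (real s * q\<^sup>2 + q ^ 6)" by (simp add: distrib_right)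
    finally show "real (card ?S) * (2582 * ln (real n)) + real n * ?D
        \<le> (57344 * K + 4566) * (real s * ln (real n) + ln (real n) ^ 3)"
      unfolding 4 unfolding qq .
  qed
  finally show ?thesis by (simp add: K_def)
qed

theorem theorem4:
  "\<exists>Ccal0. \<forall>Ccal\<ge>Ccal0. \<exists>C>0. \<exists>N0>0. \<exists>c0>0. \<exists>c1>0.
     \<forall>n s ahat. real n \<ge> N0 \<longrightarrow> real s \<le> c0 * real n \<longrightarrow> is_mmle n Ccal ahat \<longrightarrow>
       (c1 * (ln (real n))\<^sup>2 \<le> real s \<longrightarrow>
          (\<forall>\<theta>0\<in>ell0 n s. post_risk n ahat \<theta>0 \<le> ennreal (C * real s * ln (real n))))
       \<and> (\<forall>\<theta>0\<in>ell0 n s. post_risk n ahat \<theta>0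
              \<le> ennreal (C * (real s * ln (real n) + (ln (real n)) ^ 3)))"
\<comment> \<open>With \<open>Ccal\<close> at least 1, every admissible weight is at least 1/n,
  which is what the tail comparison of spike and slab requires.\<close>
proof (rule exI[of _ 1], intro allI impI)
  fix Ccal :: real assume Ccal: "1 \<le> Ccal"
  define B where "B = 57344 * (320000 + Ccal) + 4566"
  have B: "0 < B" using Ccal by (simp add: B_def)
  show "\<exists>C>0. \<exists>N0>0. \<exists>c0>0. \<exists>c1>0.
     \<forall>n s ahat. real n \<ge> N0 \<longrightarrow> real s \<le> c0 * real n \<longrightarrow> is_mmle n Ccal ahat \<longrightarrow>
       (c1 * (ln (real n))\<^sup>2 \<le> real s \<longrightarrow>
          (\<forall>\<theta>0\<in>ell0 n s. post_risk n ahat \<theta>0 \<le> ennreal (C * real s * ln (real n))))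
       \<and> (\<forall>\<theta>0\<in>ell0 n s. post_risk n ahat \<theta>0
              \<le> ennreal (C * (real s * ln (real n) + (ln (real n)) ^ 3)))"
  \<comment> \<open>Doubling B serves both claims: when s is at least log^2 n, the term log^3 n is
    at most s log n.\<close>
  proof (rule exI[of _ "2 * B"], intro conjI, goal_cases)
    case 1 then show ?case using B by simp
  next
    case 2 show ?case
    \<comment> \<open>The witnesses are \<open>N0\<close> = 400000, \<open>c0\<close> = 1/2, which
      leaves at least half of the coordinates null, and \<open>c1\<close> = 1.\<close>
    proof (rule exI[of _ 400000], intro conjI, simp, rule exI[of _ "1/2"], intro conjI, simp,
        rule exI[of _ 1], intro conjI, simp, intro allI impI conjI ballI)
      fix n s ahat \<theta>0
      assume n: "400000 \<le> real n" and s: "real s \<le> 1/2 * real n" and mle: "is_mmle n Ccal ahat"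
        and \<theta>: "\<theta>0 \<in> ell0 n s"
      have n': "400000 \<le> n" using n by linarith
      have L: "1 \<le> ln (real n)" by (rule ln_ge_1[OF n'])
      have risk: "post_risk n ahat \<theta>0 \<le> ennreal (B * (real s * ln (real n) + ln (real n) ^ 3))"
        unfolding B_def by (rule post_risk_le[OF n' Ccal mle \<theta> s])
      have "B * (real s * ln (real n) + ln (real n) ^ 3) \<le> 2 * B * (real s * ln (real n) + ln (real n) ^ 3)"
        using B L by (intro mult_right_mono add_nonneg_nonneg) auto
      with risk show "post_risk n ahat \<theta>0 \<le> ennreal (2 * B * (real s * ln (real n) + ln (real n) ^ 3))"
        by (meson ennreal_leI order_trans)
      assume "1 * (ln (real n))\<^sup>2 \<le> real s"
      then have "(ln (real n))\<^sup>2 * ln (real n) \<le> real s * ln (real n)"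
        using L by (intro mult_right_mono) auto
      then have "ln (real n) ^ 3 \<le> real s * ln (real n)"
        by (simp add: power2_eq_square power3_eq_cube)
      then have "B * (real s * ln (real n) + ln (real n) ^ 3) \<le> B * (2 * (real s * ln (real n)))"
        using B by (intro mult_left_mono) auto
      with risk show "post_risk n ahat \<theta>0 \<le> ennreal (2 * B * real s * ln (real n))"
        by (auto intro!: order_trans[OF risk] ennreal_leI simp: mult_ac)
    qed
  qed
qed

end
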